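(* Let $(H,\Delta,\epsilon,\Phi,S,\alpha,\beta)$ be a quasi-Hopf algebra with bijective antipode, with Drinfeld twist $F_\delta$, and let $G\in H\otimes H$ be a twist. Let $F_\delta^G$ denote the Drinfeld twist of the quasi-Hopf algebra $(H,\Delta_G,\epsilon,\Phi_G,S,\alpha_G,\beta_G)$ obtained by twisting $H$ with $G$. Then under the twisted structure induced by $G$, $F_\delta^{-1}$ is twisted to $$(F_\delta^G)^{-1}=G\cdot F_\delta^{-1}\cdot(S\otimes S)G^T .$$
   Context: A quasi-bialgebra $(H,\Delta,\epsilon,\Phi)$ over a field $k$ is a unital associative $k$-algebra $H$ with algebra homomorphisms $\epsilon:H\to k$, $\Delta:H\to H\otimes H$ and an invertible $\Phi\in H\otimes H\otimes H$ such that (with $1$ also denoting the identity map) $(1\otimes\Delta)\Delta(a)=\Phi^{-1}(\Delta\otimes 1)\Delta(a)\Phi$ for all $a\in H$; $(\Delta\otimes 1\otimes 1)\Phi\cdot(1\otimes 1\otimes\Delta)\Phi=(\Phi\otimes 1)\cdot(1\otimes\Delta\otimes 1)\Phi\cdot(1\otimes\Phi)$; $(\epsilon\otimes 1)\Delta=1=(1\otimes\epsilon)\Delta$; $(1\otimes\epsilon\otimes 1)\Phi=1$. Write $\Phi=\sum_\nu X_\nu\otimes Y_\nu\otimes Z_\nu$, $\Phi^{-1}=\sum_\nu\bar X_\nu\otimes\bar Y_\nu\otimes\bar Z_\nu$, $\Delta(a)=\sum a_{(1)}\otimes a_{(2)}$. A quasi-Hopf algebra $(H,\Delta,\epsilon,\Phi,S,\alpha,\beta)$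 is a quasi-bialgebra with an algebra anti-homomorphism $S:H\to H$ (assumed bijective) and $\alpha,\beta\in H$ such that $\sum S(X_\nu)\alpha Y_\nu\beta S(Z_\nu)=1=\sum\bar X_\nu\beta S(\bar Y_\nu)\alpha\bar Z_\nu$ and $\sum S(a_{(1)})\alpha a_{(2)}=\epsilon(a)\alpha$, $\sum a_{(1)}\beta S(a_{(2)})=\epsilon(a)\beta$ for all $a\in H$. $T$ is the flip $T(a\otimes b)=b\otimes a$, $\Delta^T=T\circ\Delta$, $G^T=T(G)$. A twist is an invertible $G\in H\otimes H$ with $(\epsilon\otimes 1)G=(1\otimes\epsilon)G=1$. With $G=\sum g_i\otimes g^i$, $G^{-1}=\sum\bar g_i\otimes\bar g^i$, the structure twisted by $G$ has the same $\epsilon$ and $S$, and $\Delta_G(a)=G\Delta(a)G^{-1}$, $\Phi_G=(G\otimes 1)\cdot(\Delta\otimes 1)G\cdot\Phi\cdot(1\otimes\Delta)G^{-1}\cdot(1\otimes G^{-1})$, $\alpha_G=\sum S(\bar g_i)\alpha\bar g^i$, $\beta_G=\sum g_i\beta S(g^i)$. The Drinfeld twist of a quasi-Hopf algebra is $$F_\delta=\sum_\nu (S\otimes S)\Delta^T(X_\nu)\cdot\gamma\cdot\Delta(Y_\nu\beta S(Z_\nu)),\qquad \gamma=\sum_i S(B_i)\alpha C_i\otimes S(A_i)\alpha D_i,$$ where $\sum_i A_i\otimes B_i\otimes C_i\otimes D_i=(\Phi^{-1}\otimes 1)\cdot(\Delta\otimes 1\otimes 1)\Phi$. It is invertible, with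 inverse $$F_\delta^{-1}=\sum_\nu\Delta(S(X_\nu)\alpha Y_\nu)\cdot\bar\gamma\cdot(S\otimes S)\Delta^T(Z_\nu),\qquad \bar\gamma=\sum_i\bar A_i\beta S(\bar D_i)\otimes\bar B_i\beta S(\bar C_i),$$ where $\sum_i\bar A_i\otimes\bar B_i\otimes\bar C_i\otimes\bar D_i=(\Delta\otimes 1\otimes 1)\Phi^{-1}\cdot(\Phi\otimes 1)$. $F_\delta^G$ and $(F_\delta^G)^{-1}$ are given by the same formulas with $(\Delta,\Phi,\alpha,\beta)$ replaced by $(\Delta_G,\Phi_G,\alpha_G,\beta_G)$. *)

theory Defs
  imports Complex_Main "HOL-Library.Poly_Mapping" "HOL-Algebra.Ring"
begin

section \<open>Tensor powers of a \<open>k\<close>-algebra\<close>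

text \<open>
  \<open>H\<close> is a type of class \<open>ring_1\<close>, with the scalar action \<open>sc\<close> of the field \<open>k\<close> as an explicit
  parameter. Its \<open>n\<close>-th tensor power over \<open>k\<close> is the free vector space on the words of length
  \<open>n\<close> over \<open>H\<close>, modulo the subspace generated by the multilinearity relations; a tensor is a
  coset. All tensor powers share one type and are told apart by their carriers.
\<close>

type_synonym ('h, 'k) formal_tensor = "'h list \<Rightarrow>\<^sub>0 'k"
type_synonym ('h, 'k) tensor = "('h, 'k) formal_tensor set"

locale k_algebra = vector_space sc
  for sc :: "'k::field \<Rightarrow> 'h::ring_1 \<Rightarrow> 'h" +
  assumes sc_mult_left: "sc c a * b = sc c (a * b)"
    and sc_mult_right: "a * sc c b = sc c (a * b)"

definition formal_scale :: "'k::field \<Rightarrow> ('h, 'k) formal_tensor \<Rightarrow> ('h, 'k) formal_tensor" where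
  "formal_scale c x = Poly_Mapping.map (\<lambda>d. c * d) x"

definition formal_tensors :: "nat \<Rightarrow> ('h, 'k::field) formal_tensor set" where
  "formal_tensors n = {x. \<forall>w\<in>Poly_Mapping.keys x. length w = n}"

definition multilinear_relators ::
    "('k::field \<Rightarrow> 'h::ring_1 \<Rightarrow> 'h) \<Rightarrow> nat \<Rightarrow> ('h, 'k) formal_tensor set" where
  "multilinear_relators sc n =
     {Poly_Mapping.single (u @ [a + b] @ v) 1 - Poly_Mapping.single (u @ [a] @ v) 1
        - Poly_Mapping.single (u @ [b] @ v) 1 | u a b v. length u + 1 + length v = n} \<union>
     {Poly_Mapping.single (u @ [sc c a] @ v) 1 - Poly_Mapping.single (u @ [a] @ v) c
        | u c a v. length u + 1 + length v = n}"

definition tensor_rel ::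
    "('k::field \<Rightarrow> 'h::ring_1 \<Rightarrow> 'h) \<Rightarrow> nat \<Rightarrow> ('h, 'k) formal_tensor rel" where
  "tensor_rel sc n =
     {(x, y). x \<in> formal_tensors n \<and> y \<in> formal_tensors n \<and>
        x - y \<in> module.span formal_scale (multilinear_relators sc n)}"

definition tensor_class ::
    "('k::field \<Rightarrow> 'h::ring_1 \<Rightarrow> 'h) \<Rightarrow> nat \<Rightarrow> ('h, 'k) formal_tensor \<Rightarrow> ('h, 'k) tensor" where
  "tensor_class sc n x = tensor_rel sc n `` {x}"

definition tensor_rep :: "('h, 'k::field) tensor \<Rightarrow> ('h, 'k) formal_tensor" where
  "tensor_rep X = (SOME x. x \<in> X)"

text \<open>The pure tensor \<open>a\<^sub>1 \<otimes> \<dots> \<otimes> a\<^sub>n\<close> is \<open>pure_tensor sc [a\<^sub>1, \<dots>, a\<^sub>n]\<close>.\<close>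

definition pure_tensor ::
    "('k::field \<Rightarrow> 'h::ring_1 \<Rightarrow> 'h) \<Rightarrow> 'h list \<Rightarrow> ('h, 'k) tensor" where
  "pure_tensor sc w = tensor_class sc (length w) (Poly_Mapping.single w 1)"

text \<open>
  In this record the infix product, printed with the circled-times symbol, is the multiplication
  of the algebra \<open>H \<otimes> \<dots> \<otimes> H\<close> (factor by factor on pure tensors), not the formation of a tensor
  product.
\<close>

definition tensor_power ::
    "('k::field \<Rightarrow> 'h::ring_1 \<Rightarrow> 'h) \<Rightarrow> nat \<Rightarrow> ('h, 'k) tensor ring" where
  "tensor_power sc n =
     \<lparr>carrier = formal_tensors n // tensor_rel sc n,
      mult = (\<lambda>X Y. let x = tensor_rep X; y = tensor_rep Y in
        tensor_class sc n
          (\<Sum>u\<in>Poly_Mapping.keys x. \<Sum>v\<in>Poly_Mapping.keys y.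
             Poly_Mapping.single (map2 (*) u v)
               (Poly_Mapping.lookup x u * Poly_Mapping.lookup y v))),
      one = pure_tensor sc (replicate n 1),
      zero = tensor_class sc n 0,
      add = (\<lambda>X Y. tensor_class sc n (tensor_rep X + tensor_rep Y))\<rparr>"

definition tensor_scale ::
    "('k::field \<Rightarrow> 'h::ring_1 \<Rightarrow> 'h) \<Rightarrow> nat \<Rightarrow> 'k \<Rightarrow> ('h, 'k) tensor \<Rightarrow> ('h, 'k) tensor" where
  "tensor_scale sc n c X = tensor_class sc n (formal_scale c (tensor_rep X))"

text \<open>
  The linear map on a tensor power of \<open>H\<close> induced by a map \<open>f\<close> that is multilinear in the letters
  of a word, with values in the vector space with scalar action \<open>s\<close> (\<open>tensor_eval\<close>), respectively
  in the \<open>m\<close>-th tensor power (\<open>tensor_lift\<close>). If \<open>X = \<Sum> a \<otimes> b \<otimes> c\<close>, then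
  \<open>tensor_eval s (\<lambda>w. f (w ! 0) (w ! 1) (w ! 2)) X\<close> is \<open>\<Sum> f a b c\<close>. For \<open>f\<close> that is not
  multilinear the value depends on the chosen representative.
\<close>

definition tensor_eval ::
    "('k::field \<Rightarrow> 'v::ab_group_add \<Rightarrow> 'v) \<Rightarrow> ('h list \<Rightarrow> 'v) \<Rightarrow> ('h, 'k) tensor \<Rightarrow> 'v" where
  "tensor_eval s f X =
     (\<Sum>w\<in>Poly_Mapping.keys (tensor_rep X). s (Poly_Mapping.lookup (tensor_rep X) w) (f w))"

definition tensor_lift ::
    "('k::field \<Rightarrow> 'h::ring_1 \<Rightarrow> 'h) \<Rightarrow> nat \<Rightarrow> ('h list \<Rightarrow> ('h, 'k) tensor)
      \<Rightarrow> ('h, 'k) tensor \<Rightarrow> ('h, 'k) tensor" where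
  "tensor_lift sc m f X = tensor_class sc m (tensor_eval formal_scale (\<lambda>w. tensor_rep (f w)) X)"

text \<open>\<open>X \<otimes> 1\<close> and \<open>1 \<otimes> X\<close> for \<open>X\<close> in the \<open>n\<close>-th tensor power, and the flip of \<open>H \<otimes> H\<close>.\<close>

definition tensor_one_right ::
    "('k::field \<Rightarrow> 'h::ring_1 \<Rightarrow> 'h) \<Rightarrow> nat \<Rightarrow> ('h, 'k) tensor \<Rightarrow> ('h, 'k) tensor" where
  "tensor_one_right sc n X = tensor_lift sc (n + 1) (\<lambda>w. pure_tensor sc (w @ [1])) X"

definition tensor_one_left ::
    "('k::field \<Rightarrow> 'h::ring_1 \<Rightarrow> 'h) \<Rightarrow> nat \<Rightarrow> ('h, 'k) tensor \<Rightarrow> ('h, 'k) tensor" where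
  "tensor_one_left sc n X = tensor_lift sc (n + 1) (\<lambda>w. pure_tensor sc (1 # w)) X"

definition tensor_flip ::
    "('k::field \<Rightarrow> 'h::ring_1 \<Rightarrow> 'h) \<Rightarrow> ('h, 'k) tensor \<Rightarrow> ('h, 'k) tensor" where
  "tensor_flip sc X = tensor_lift sc 2 (\<lambda>w. pure_tensor sc [w ! 1, w ! 0]) X"


section \<open>Quasi-bialgebras and quasi-Hopf algebras\<close>

record (overloaded) ('k, 'h) quasi_bialg =
  scal :: "'k \<Rightarrow> 'h \<Rightarrow> 'h"
  comult :: "'h \<Rightarrow> ('h, 'k) tensor"
  counit :: "'h \<Rightarrow> 'k"
  reassoc :: "('h, 'k) tensor"

record (overloaded) ('k, 'h) quasi_hopf = "('k, 'h) quasi_bialg" +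
  antipode :: "'h \<Rightarrow> 'h"
  antipode_alpha :: 'h
  antipode_beta :: 'h

abbreviation tpow ::
    "('k::field, 'h::ring_1, 'm) quasi_bialg_scheme \<Rightarrow> nat \<Rightarrow> ('h, 'k) tensor ring" where
  "tpow Q n \<equiv> tensor_power (scal Q) n"

text \<open>
  \<open>comult_at Q n i\<close> applies \<open>\<Delta>\<close> to the tensor factor with index \<open>i\<close> (counted from 0) of the
  \<open>n\<close>-th tensor power: for \<open>n = 3\<close>, index 0 is \<open>\<Delta> \<otimes> 1 \<otimes> 1\<close> and index 2 is \<open>1 \<otimes> 1 \<otimes> \<Delta>\<close>.
\<close>

definition comult_at ::
    "('k::field, 'h::ring_1, 'm) quasi_bialg_scheme \<Rightarrow> nat \<Rightarrow> nat
      \<Rightarrow> ('h, 'k) tensor \<Rightarrow> ('h, 'k) tensor" where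
  "comult_at Q n i X =
     tensor_lift (scal Q) (n + 1)
       (\<lambda>w. tensor_lift (scal Q) (n + 1)
          (\<lambda>u. pure_tensor (scal Q) (take i w @ u @ drop (Suc i) w)) (comult Q (w ! i))) X"

locale quasi_bialgebra =
  fixes Q :: "('k::field, 'h::ring_1, 'm) quasi_bialg_scheme"
  assumes algebra: "k_algebra (scal Q)"
    and counit_add: "counit Q (a + b) = counit Q a + counit Q b"
    and counit_scal: "counit Q (scal Q c a) = c * counit Q a"
    and counit_mult: "counit Q (a * b) = counit Q a * counit Q b"
    and counit_one: "counit Q 1 = 1"
    and comult_closed: "comult Q a \<in> carrier (tpow Q 2)"
    and comult_add: "comult Q (a + b) = comult Q a \<oplus>\<^bsub>tpow Q 2\<^esub> comult Q b"
    and comult_scal: "comult Q (scal Q c a) = tensor_scale (scal Q) 2 c (comult Q a)"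
    and comult_mult: "comult Q (a * b) = comult Q a \<otimes>\<^bsub>tpow Q 2\<^esub> comult Q b"
    and comult_one: "comult Q 1 = \<one>\<^bsub>tpow Q 2\<^esub>"
    and reassoc_unit: "reassoc Q \<in> Units (tpow Q 3)"
    and quasi_coassoc:
      "comult_at Q 2 1 (comult Q a) =
         inv\<^bsub>tpow Q 3\<^esub> (reassoc Q) \<otimes>\<^bsub>tpow Q 3\<^esub> comult_at Q 2 0 (comult Q a)
           \<otimes>\<^bsub>tpow Q 3\<^esub> reassoc Q"
    and pentagon:
      "comult_at Q 3 0 (reassoc Q) \<otimes>\<^bsub>tpow Q 4\<^esub> comult_at Q 3 2 (reassoc Q) =
         tensor_one_right (scal Q) 3 (reassoc Q)
           \<otimes>\<^bsub>tpow Q 4\<^esub> comult_at Q 3 1 (reassoc Q)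
           \<otimes>\<^bsub>tpow Q 4\<^esub> tensor_one_left (scal Q) 3 (reassoc Q)"
    and counit_left:
      "tensor_eval (scal Q) (\<lambda>w. scal Q (counit Q (w ! 0)) (w ! 1)) (comult Q a) = a"
    and counit_right:
      "tensor_eval (scal Q) (\<lambda>w. scal Q (counit Q (w ! 1)) (w ! 0)) (comult Q a) = a"
    and counit_reassoc:
      "tensor_lift (scal Q) 2
         (\<lambda>w. pure_tensor (scal Q) [scal Q (counit Q (w ! 1)) (w ! 0), w ! 2]) (reassoc Q)
       = \<one>\<^bsub>tpow Q 2\<^esub>"

locale quasi_hopf_algebra = quasi_bialgebra Q
  for Q :: "('k::field, 'h::ring_1, 'm) quasi_hopf_scheme" +
  assumes antipode_add: "antipode Q (a + b) = antipode Q a + antipode Q b"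
    and antipode_scal: "antipode Q (scal Q c a) = scal Q c (antipode Q a)"
    and antipode_mult: "antipode Q (a * b) = antipode Q b * antipode Q a"
    and antipode_one: "antipode Q 1 = 1"
    and antipode_bij: "bij (antipode Q)"
    and antipode_reassoc:
      "tensor_eval (scal Q)
         (\<lambda>w. antipode Q (w ! 0) * antipode_alpha Q * (w ! 1) * antipode_beta Q
                * antipode Q (w ! 2)) (reassoc Q) = 1"
    and antipode_reassoc_inv:
      "tensor_eval (scal Q)
         (\<lambda>w. (w ! 0) * antipode_beta Q * antipode Q (w ! 1) * antipode_alpha Q * (w ! 2))
         (inv\<^bsub>tpow Q 3\<^esub> (reassoc Q)) = 1"
    and antipode_left:
      "tensor_eval (scal Q) (\<lambda>w. antipode Q (w ! 0) * antipode_alpha Q * (w ! 1)) (comult Q a)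
       = scal Q (counit Q a) (antipode_alpha Q)"
    and antipode_right:
      "tensor_eval (scal Q) (\<lambda>w. (w ! 0) * antipode_beta Q * antipode Q (w ! 1)) (comult Q a)
       = scal Q (counit Q a) (antipode_beta Q)"


section \<open>Twisting\<close>

definition is_twist ::
    "('k::field, 'h::ring_1, 'm) quasi_bialg_scheme \<Rightarrow> ('h, 'k) tensor \<Rightarrow> bool" where
  "is_twist Q G \<longleftrightarrow>
     G \<in> Units (tpow Q 2) \<and>
     tensor_eval (scal Q) (\<lambda>w. scal Q (counit Q (w ! 0)) (w ! 1)) G = 1 \<and>
     tensor_eval (scal Q) (\<lambda>w. scal Q (counit Q (w ! 1)) (w ! 0)) G = 1"

definition twisted ::
    "('k::field, 'h::ring_1, 'm) quasi_hopf_scheme \<Rightarrow> ('h, 'k) tensor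
      \<Rightarrow> ('k, 'h, 'm) quasi_hopf_scheme" where
  "twisted Q G = (let Gi = inv\<^bsub>tpow Q 2\<^esub> G in
     Q\<lparr>comult := (\<lambda>a. G \<otimes>\<^bsub>tpow Q 2\<^esub> comult Q a \<otimes>\<^bsub>tpow Q 2\<^esub> Gi),
       reassoc := tensor_one_right (scal Q) 2 G \<otimes>\<^bsub>tpow Q 3\<^esub> comult_at Q 2 0 G
         \<otimes>\<^bsub>tpow Q 3\<^esub> reassoc Q \<otimes>\<^bsub>tpow Q 3\<^esub> comult_at Q 2 1 Gi
         \<otimes>\<^bsub>tpow Q 3\<^esub> tensor_one_left (scal Q) 2 Gi,
       antipode_alpha :=
         tensor_eval (scal Q) (\<lambda>w. antipode Q (w ! 0) * antipode_alpha Q * (w ! 1)) Gi,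
       antipode_beta :=
         tensor_eval (scal Q) (\<lambda>w. (w ! 0) * antipode_beta Q * antipode Q (w ! 1)) G\<rparr>)"


section \<open>The Drinfeld twist\<close>

definition antipode_tensor ::
    "('k::field, 'h::ring_1, 'm) quasi_hopf_scheme \<Rightarrow> ('h, 'k) tensor \<Rightarrow> ('h, 'k) tensor" where
  "antipode_tensor Q X =
     tensor_lift (scal Q) 2 (\<lambda>w. pure_tensor (scal Q) [antipode Q (w ! 0), antipode Q (w ! 1)]) X"

definition drinfeld_gamma ::
    "('k::field, 'h::ring_1, 'm) quasi_hopf_scheme \<Rightarrow> ('h, 'k) tensor" where
  "drinfeld_gamma Q =
     tensor_lift (scal Q) 2
       (\<lambda>w. pure_tensor (scal Q)
          [antipode Q (w ! 1) * antipode_alpha Q * (w ! 2),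
           antipode Q (w ! 0) * antipode_alpha Q * (w ! 3)])
       (tensor_one_right (scal Q) 3 (inv\<^bsub>tpow Q 3\<^esub> (reassoc Q))
          \<otimes>\<^bsub>tpow Q 4\<^esub> comult_at Q 3 0 (reassoc Q))"

definition drinfeld_gamma_bar ::
    "('k::field, 'h::ring_1, 'm) quasi_hopf_scheme \<Rightarrow> ('h, 'k) tensor" where
  "drinfeld_gamma_bar Q =
     tensor_lift (scal Q) 2
       (\<lambda>w. pure_tensor (scal Q)
          [(w ! 0) * antipode_beta Q * antipode Q (w ! 3),
           (w ! 1) * antipode_beta Q * antipode Q (w ! 2)])
       (comult_at Q 3 0 (inv\<^bsub>tpow Q 3\<^esub> (reassoc Q))
          \<otimes>\<^bsub>tpow Q 4\<^esub> tensor_one_right (scal Q) 3 (reassoc Q))"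

definition drinfeld_twist ::
    "('k::field, 'h::ring_1, 'm) quasi_hopf_scheme \<Rightarrow> ('h, 'k) tensor" where
  "drinfeld_twist Q =
     tensor_lift (scal Q) 2
       (\<lambda>w. antipode_tensor Q (tensor_flip (scal Q) (comult Q (w ! 0)))
          \<otimes>\<^bsub>tpow Q 2\<^esub> drinfeld_gamma Q
          \<otimes>\<^bsub>tpow Q 2\<^esub> comult Q ((w ! 1) * antipode_beta Q * antipode Q (w ! 2)))
       (reassoc Q)"

text \<open>Drinfeld's explicit formula for the inverse of \<open>drinfeld_twist Q\<close>.\<close>

definition drinfeld_twist_inv ::
    "('k::field, 'h::ring_1, 'm) quasi_hopf_scheme \<Rightarrow> ('h, 'k) tensor" where
  "drinfeld_twist_inv Q =
     tensor_lift (scal Q) 2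
       (\<lambda>w. comult Q (antipode Q (w ! 0) * antipode_alpha Q * (w ! 1))
          \<otimes>\<^bsub>tpow Q 2\<^esub> drinfeld_gamma_bar Q
          \<otimes>\<^bsub>tpow Q 2\<^esub> antipode_tensor Q (tensor_flip (scal Q) (comult Q (w ! 2))))
       (reassoc Q)"

end

theory Submission
  imports Defs
begin

text \<open>
  Why the theorem holds. In the formulas for the Drinfeld twist, \<open>\<alpha>\<close> and \<open>\<beta>\<close> join two tensor
  factors by \<open>S(a) \<alpha> b\<close> and \<open>a \<beta> S(b)\<close>. A tensor multiplied into two factors that are joined in
  this way can be absorbed into \<open>\<alpha>\<close> or \<open>\<beta>\<close>: replacing \<open>\<alpha>\<close> by \<open>\<alpha>\<^sub>G\<close> amounts to multiplying these
  factors by \<open>G\<^sup>-\<^sup>1\<close> from the left, and replacing \<open>\<beta>\<close> by \<open>\<beta>\<^sub>G\<close> amounts to multiplying them by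
  \<open>G\<close> from the right (\<open>gamma_map_absorb\<close>, \<open>drinfeld_map_absorb\<close>). A coproduct in these positions
  is removed by the antipode axioms and leaves only its counit (\<open>gamma_map_comult_middle\<close>). In
  \<open>\<Phi>\<^sub>G\<close> the factors \<open>G\<close> and \<open>G\<^sup>-\<^sup>1\<close> stand in the positions where these two mechanisms apply.

  For \<open>\<gamma>'\<close> (written with a bar above \<open>\<gamma>\<close>), writing out the twisted \<open>(\<Delta> \<otimes> 1 \<otimes> 1)\<Phi>\<^sup>-\<^sup>1 \<cdot> (\<Phi> \<otimes> 1)\<close>,
  moving \<open>((\<Delta> \<otimes> 1)\<Delta> \<otimes> 1)G\<^sup>-\<^sup>1\<close> past \<open>\<Phi> \<otimes> 1\<close> by quasi-coassociativity and cancelling gives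
  \<open>G\<^sup>-\<^sup>1 \<gamma>'\<^sub>G (S \<otimes> S)(G\<^sup>-\<^sup>1)\<^sup>T = \<Sum> \<Delta>(g) \<gamma>' (S \<otimes> S)\<Delta>\<^sup>T(h)\<close> for \<open>G = \<Sum> g \<otimes> h\<close>
  (\<open>gamma_bar_twisted\<close>). Inserting this into the formula for the inverse Drinfeld twist turns
  \<open>\<Phi>\<^sub>G\<close> into \<open>(\<Delta> \<otimes> 1)G \<cdot> \<Phi> \<cdot> (1 \<otimes> \<Delta>)G\<^sup>-\<^sup>1\<close> between the outer factors \<open>G\<close> and \<open>(S \<otimes> S)G\<^sup>T\<close>. The
  left factor disappears by \<open>\<Sum> S(x\<^sub>1) \<alpha> x\<^sub>2 = \<epsilon>(x) \<alpha>\<close>, the right one by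
  \<open>\<Sum> \<Delta>(x\<^sub>1) \<gamma>' (S \<otimes> S)\<Delta>\<^sup>T(x\<^sub>2) = \<epsilon>(x) \<gamma>'\<close> (\<open>gamma_invariant\<close>), which is again
  quasi-coassociativity together with the antipode axiom. The mirror image of this computation
  gives \<open>F\<^sub>G = (S \<otimes> S)(G\<^sup>-\<^sup>1)\<^sup>T \<cdot> F \<cdot> G\<^sup>-\<^sup>1\<close> for the Drinfeld twist itself, so that the
  assertion about the ring inverse follows from invertibility of \<open>F\<close> and \<open>G\<close> alone.

  The calculus rests on the fact that every tensor is a sum of pure tensors (\<open>tensor_induct\<close>):
  all auxiliary identities are additive in each tensor and are checked on pure tensors, while
  the main computations take place in the rings \<open>H\<^sup>\<otimes>\<^sup>2\<close>, \<open>H\<^sup>\<otimes>\<^sup>3\<close> and \<open>H\<^sup>\<otimes>\<^sup>4\<close>.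
\<close>

section \<open>Formal tensors and linear extension\<close>

lemma lookup_formal_scale [simp]:
  "Poly_Mapping.lookup (formal_scale c x) w = c * Poly_Mapping.lookup x w"
  by (simp add: formal_scale_def Poly_Mapping.map.rep_eq when_def)

global_interpretation formal: vector_space "formal_scale :: 'k::field \<Rightarrow> ('h, 'k) formal_tensor \<Rightarrow> _"
  by unfold_locales
    (auto intro!: poly_mapping_eqI simp: lookup_add algebra_simps)

lemma keys_formal_scale: "Poly_Mapping.keys (formal_scale c x) \<subseteq> Poly_Mapping.keys x"
  by (auto simp: in_keys_iff)

lemma formal_scale_single [simp]:
  "formal_scale c (Poly_Mapping.single w d) = Poly_Mapping.single w (c * d)"
  by (auto intro!: poly_mapping_eqI simp: lookup_single when_def)

lemma subspace_formal_tensors: "formal.subspace (formal_tensors n)"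
  using keys_formal_scale Poly_Mapping.keys_add
  unfolding formal.subspace_def formal_tensors_def by fastforce

lemmas formal_tensors_closed [simp] =
  formal.subspace_0[OF subspace_formal_tensors]
  formal.subspace_add[OF subspace_formal_tensors]
  formal.subspace_scale[OF subspace_formal_tensors]
  formal.subspace_neg[OF subspace_formal_tensors]
  formal.subspace_diff[OF subspace_formal_tensors]

lemma single_in_formal_tensors [simp]: "length w = n \<Longrightarrow> Poly_Mapping.single w c \<in> formal_tensors n"
  by (simp add: formal_tensors_def)

text \<open>The linear extension of a function on words; \<open>tensor_eval\<close> is its value on a representative.\<close>

definition linear_ext :: "('k::field \<Rightarrow> 'v::ab_group_add \<Rightarrow> 'v) \<Rightarrow> ('h list \<Rightarrow> 'v)
    \<Rightarrow> ('h, 'k) formal_tensor \<Rightarrow> 'v" where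
  "linear_ext s f x = (\<Sum>w\<in>Poly_Mapping.keys x. s (Poly_Mapping.lookup x w) (f w))"

lemma tensor_eval_linear_ext: "tensor_eval s f X = linear_ext s f (tensor_rep X)"
  by (simp add: tensor_eval_def linear_ext_def)

lemma linear_ext_cong:
  "(\<And>w. length w = n \<Longrightarrow> f w = g w) \<Longrightarrow> x \<in> formal_tensors n \<Longrightarrow> linear_ext s f x = linear_ext s g x"
  unfolding linear_ext_def formal_tensors_def by (auto intro!: sum.cong)

context vector_space
begin

lemma linear_ext_superset:
  assumes "finite A" "Poly_Mapping.keys x \<subseteq> A"
  shows "linear_ext scale f x = (\<Sum>w\<in>A. scale (Poly_Mapping.lookup x w) (f w))"
  unfolding linear_ext_def using assms
  by (intro sum.mono_neutral_left) (auto simp: in_keys_iff)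

lemma linear_ext_add:
  "linear_ext scale f (x + y) = linear_ext scale f x + linear_ext scale f y"
proof -
  let ?A = "Poly_Mapping.keys x \<union> Poly_Mapping.keys y"
  have "Poly_Mapping.keys (x + y) \<subseteq> ?A"
    by (rule Poly_Mapping.keys_add)
  then show ?thesis
    by (simp add: linear_ext_superset[of ?A] lookup_add scale_left_distrib sum.distrib)
qed

lemma linear_ext_scale:
  "linear_ext scale f (formal_scale c x) = scale c (linear_ext scale f x)"
  by (subst linear_ext_superset[OF _ keys_formal_scale])
      (simp_all add: linear_ext_def scale_sum_right)

lemma linear_ext_single [simp]: "linear_ext scale f (Poly_Mapping.single w c) = scale c (f w)"
  by (simp add: linear_ext_superset[of "{w}"])

lemma linear_ext_zero [simp]: "linear_ext scale f 0 = 0"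
  by (simp add: linear_ext_def)

lemma linear_ext_uminus: "linear_ext scale f (- x) = - linear_ext scale f x"
  using linear_ext_add[of f x "- x"] by (simp add: add.inverse_unique)

lemma linear_ext_diff:
  "linear_ext scale f (x - y) = linear_ext scale f x - linear_ext scale f y"
  using linear_ext_add[of f x "- y"] by (simp add: linear_ext_uminus)

lemma linear_ext_in_subspace:
  "subspace U \<Longrightarrow> (\<And>w. w \<in> Poly_Mapping.keys x \<Longrightarrow> f w \<in> U) \<Longrightarrow> linear_ext scale f x \<in> U"
  unfolding linear_ext_def by (intro subspace_sum subspace_scale)

end

context k_algebra
begin

abbreviation T :: "nat \<Rightarrow> ('h, 'k) tensor ring" where "T \<equiv> tensor_power sc"
abbreviation pure :: "'h list \<Rightarrow> ('h, 'k) tensor" where "pure \<equiv> pure_tensor sc"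
abbreviation tsc :: "nat \<Rightarrow> 'k \<Rightarrow> ('h, 'k) tensor \<Rightarrow> ('h, 'k) tensor" where "tsc \<equiv> tensor_scale sc"

text \<open>
  Multilinearity modulo a subspace \<open>U\<close> covers both kinds of targets: for values in \<open>H\<close> take
  \<open>U = {0}\<close>, for values in a tensor power take representatives modulo its relators.
\<close>

definition multilinear_mod where
  "multilinear_mod s U n f \<longleftrightarrow>
     (\<forall>w i a b. length w = n \<longrightarrow> i < n \<longrightarrow>
        f (w[i := a + b]) - f (w[i := a]) - f (w[i := b]) \<in> U) \<and>
     (\<forall>w i c a. length w = n \<longrightarrow> i < n \<longrightarrow> f (w[i := sc c a]) - s c (f (w[i := a])) \<in> U)"

lemma multilinear_modD:
  assumes "multilinear_mod s U n f" "length w = n" "i < n"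
  shows "f (w[i := a + b]) - f (w[i := a]) - f (w[i := b]) \<in> U"
    and "f (w[i := sc c a]) - s c (f (w[i := a])) \<in> U"
  using assms by (auto simp: multilinear_mod_def)

text \<open>
  This is the well-definedness of induced maps on the quotient: a linear extension sends each
  generating relator to a defect of multilinearity.
\<close>

lemma linear_ext_relators:
  assumes s: "vector_space s" and U: "module.subspace s U" and f: "multilinear_mod s U n f"
    and x: "x \<in> formal.span (multilinear_relators sc n)"
  shows "linear_ext s f x \<in> U"
proof -
  interpret s: vector_space s by (rule s)
  have upd: "(u @ [z] @ v)[length u := a] = u @ [a] @ v" for u v :: "'h list" and z a
    by simp
  have "formal.span (multilinear_relators sc n) \<subseteq> {x. linear_ext s f x \<in> U}"
  proof (rule formal.span_minimal)
    show "formal.subspace {x. linear_ext s f x \<in> U}"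
      using U by (auto simp: formal.subspace_def s.subspace_def s.linear_ext_add s.linear_ext_scale)
    show "multilinear_relators sc n \<subseteq> {x. linear_ext s f x \<in> U}"
    proof
      fix r assume "r \<in> multilinear_relators sc n"
      then consider
        (add) u a b v where "length u + 1 + length v = n"
          "r = Poly_Mapping.single (u @ [a + b] @ v) 1 - Poly_Mapping.single (u @ [a] @ v) 1
            - Poly_Mapping.single (u @ [b] @ v) 1"
      | (scale) u c a v where "length u + 1 + length v = n"
          "r = Poly_Mapping.single (u @ [sc c a] @ v) 1 - Poly_Mapping.single (u @ [a] @ v) c"
        unfolding multilinear_relators_def by blast
      then show "r \<in> {x. linear_ext s f x \<in> U}"
      proof cases
        case add
        then have "f ((u @ [a] @ v)[length u := a + b]) - f ((u @ [a] @ v)[length u := a])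
            - f ((u @ [a] @ v)[length u := b]) \<in> U"
          using multilinear_modD(1)[OF f, of "u @ [a] @ v" "length u" a b] by simp
        then show ?thesis
          using add unfolding upd by (simp add: s.linear_ext_diff)
      next
        case scale
        then have "f ((u @ [a] @ v)[length u := sc c a]) - s c (f
            ((u @ [a] @ v)[length u := a])) \<in> U"
          using multilinear_modD(2)[OF f, of "u @ [a] @ v" "length u" c a] by simp
        then show ?thesis
          using scale unfolding upd by (simp add: s.linear_ext_diff)
      qed
    qed
  qed
  then show ?thesis
    using x by blast
qed

section \<open>The tensor powers as rings\<close>

lemma tensor_class_eq_iff:
  assumes "x \<in> formal_tensors n" "y \<in> formal_tensors n"
  shows "tensor_class sc n x = tensor_class sc n y \<longleftrightarrow>
    x - y \<in> formal.span (multilinear_relators sc n)"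
proof -
  have "equiv (formal_tensors n) (tensor_rel sc n)"
  proof (rule equivI)
    show "tensor_rel sc n \<subseteq> formal_tensors n \<times> formal_tensors n"
      by (auto simp: tensor_rel_def)
    show "refl_on (formal_tensors n) (tensor_rel sc n)"
      by (auto simp: refl_on_def tensor_rel_def formal.span_zero)
    show "sym (tensor_rel sc n)"
      unfolding sym_def tensor_rel_def
      by (auto dest: formal.span_neg simp only: minus_diff_eq mem_Collect_eq case_prod_conv)
    show "trans (tensor_rel sc n)"
    proof (rule transI)
      fix x y z assume "(x, y) \<in> tensor_rel sc n" "(y, z) \<in> tensor_rel sc n"
      then show "(x, z) \<in> tensor_rel sc n"
        using formal.span_add[of "x - y" "multilinear_relators sc n" "y - z"]
        by (simp add: tensor_rel_def)
    qed
  qed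
  from eq_equiv_class_iff[OF this assms] show ?thesis
    using assms by (simp add: tensor_class_def tensor_rel_def)
qed

lemma tensor_class_self: "x \<in> formal_tensors n \<Longrightarrow> x \<in> tensor_class sc n x"
  by (simp add: tensor_class_def tensor_rel_def formal.span_zero)

lemma carrier_T: "carrier (T n) = tensor_class sc n ` formal_tensors n"
  by (auto simp: tensor_power_def quotient_def tensor_class_def)

lemma tensor_class_closed [simp]: "x \<in> formal_tensors n \<Longrightarrow> tensor_class sc n x \<in> carrier (T n)"
  by (simp add: carrier_T)

lemma tensor_rep_class:
  assumes "x \<in> formal_tensors n"
  shows "tensor_rep (tensor_class sc n x) \<in> formal_tensors n"
    and "tensor_rep (tensor_class sc n x) - x \<in> formal.span (multilinear_relators sc n)"
proof -
  have "tensor_rep (tensor_class sc n x) \<in> tensor_class sc n x"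
    unfolding tensor_rep_def using tensor_class_self[OF assms] by (rule someI)
  then have *: "(x, tensor_rep (tensor_class sc n x)) \<in> tensor_rel sc n"
    by (simp add: tensor_class_def)
  then show "tensor_rep (tensor_class sc n x) \<in> formal_tensors n"
    by (simp add: tensor_rel_def)
  from * have "x - tensor_rep (tensor_class sc n x) \<in> formal.span (multilinear_relators sc n)"
    by (simp add: tensor_rel_def)
  from formal.span_neg[OF this]
  show "tensor_rep (tensor_class sc n x) - x \<in> formal.span (multilinear_relators sc n)"
    by simp
qed

lemma tensor_rep_closed [simp]: "X \<in> carrier (T n) \<Longrightarrow> tensor_rep X \<in> formal_tensors n"
  by (auto simp: carrier_T tensor_rep_class)

lemma class_tensor_rep [simp]:
  assumes "X \<in> carrier (T n)"
  shows "tensor_class sc n (tensor_rep X) = X"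
proof -
  from assms obtain x where x: "X = tensor_class sc n x" "x \<in> formal_tensors n"
    by (auto simp: carrier_T)
  then show ?thesis
    using tensor_class_eq_iff[OF tensor_rep_class(1) x(2)] tensor_rep_class(2)[OF x(2)] by simp
qed

lemma T_add_class:
  assumes "x \<in> formal_tensors n" "y \<in> formal_tensors n"
  shows "tensor_class sc n x \<oplus>\<^bsub>T n\<^esub> tensor_class sc n y = tensor_class sc n (x + y)"
proof -
  let ?x = "tensor_rep (tensor_class sc n x)" and ?y = "tensor_rep (tensor_class sc n y)"
  have "(?x - x) + (?y - y) \<in> formal.span (multilinear_relators sc n)"
    using assms by (intro formal.span_add tensor_rep_class) simp_all
  then have "tensor_class sc n (?x + ?y) = tensor_class sc n (x + y)"
    by (subst tensor_class_eq_iff) (simp_all add: assms tensor_rep_class(1) algebra_simps)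
  then show ?thesis
    by (simp add: tensor_power_def)
qed

lemma T_scale_class:
  assumes "x \<in> formal_tensors n"
  shows "tsc n c (tensor_class sc n x) = tensor_class sc n (formal_scale c x)"
  unfolding tensor_scale_def using formal.span_scale[OF tensor_rep_class(2)[OF assms], of c]
  by (subst tensor_class_eq_iff)
    (simp_all add: assms tensor_rep_class(1) formal.scale_right_diff_distrib)

lemma T_scale_closed [simp]: "X \<in> carrier (T n) \<Longrightarrow> tsc n c X \<in> carrier (T n)"
  by (simp add: tensor_scale_def)

lemma T_zero_class: "\<zero>\<^bsub>T n\<^esub> = tensor_class sc n 0"
  by (simp add: tensor_power_def)

lemma T_one_pure: "\<one>\<^bsub>T n\<^esub> = pure (replicate n 1)"
  by (simp add: tensor_power_def)

lemma T_abelian_group: "abelian_group (T n)"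
proof (rule abelian_groupI)
  fix X Y Z assume "X \<in> carrier (T n)" "Y \<in> carrier (T n)" "Z \<in> carrier (T n)"
  then obtain x y z where [simp]:
    "X = tensor_class sc n x" "Y = tensor_class sc n y" "Z = tensor_class sc n z"
    and x [simp]: "x \<in> formal_tensors n" "y \<in> formal_tensors n" "z \<in> formal_tensors n"
    by (auto simp: carrier_T)
  show "X \<oplus>\<^bsub>T n\<^esub> Y \<in> carrier (T n)" "X \<oplus>\<^bsub>T n\<^esub> Y = Y \<oplus>\<^bsub>T n\<^esub> X" "\<zero>\<^bsub>T n\<^esub> \<oplus>\<^bsub>T n\<^esub> X = X"
    "X \<oplus>\<^bsub>T n\<^esub> Y \<oplus>\<^bsub>T n\<^esub> Z = X \<oplus>\<^bsub>T n\<^esub> (Y \<oplus>\<^bsub>T n\<^esub> Z)"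
    by (simp_all add: T_add_class T_zero_class add_ac)
  show "\<exists>Y\<in>carrier (T n). Y \<oplus>\<^bsub>T n\<^esub> X = \<zero>\<^bsub>T n\<^esub>"
    by (intro bexI[of _ "tensor_class sc n (- x)"]) (simp_all add: T_add_class T_zero_class)
qed (simp add: T_zero_class)

lemma pure_closed [simp]: "length w = n \<Longrightarrow> pure w \<in> carrier (T n)"
  by (auto simp: pure_tensor_def)

lemma pure_update_add:
  assumes "length w = n" "i < n"
  shows "pure (w[i := a + b]) = pure (w[i := a]) \<oplus>\<^bsub>T n\<^esub> pure (w[i := b])"
proof -
  have "Poly_Mapping.single (w[i := a + b]) 1 - Poly_Mapping.single (w[i := a]) 1
      - Poly_Mapping.single (w[i := b]) 1 \<in> multilinear_relators sc n"
    using assms unfolding multilinear_relators_def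
    by (intro UnI1 CollectI exI[of _ "take i w"] exI[of _ a] exI[of _ b] exI[of _ "drop (Suc i) w"])
      (simp add: upd_conv_take_nth_drop)
  from formal.span_base[OF this] show ?thesis
    using assms
    by (simp add: pure_tensor_def T_add_class tensor_class_eq_iff algebra_simps
       )
qed

lemma pure_update_scale:
  assumes "length w = n" "i < n"
  shows "pure (w[i := sc c a]) = tsc n c (pure (w[i := a]))"
proof -
  have "Poly_Mapping.single (w[i := sc c a]) 1 - Poly_Mapping.single (w[i := a]) c
      \<in> multilinear_relators sc n"
    using assms unfolding multilinear_relators_def
    by (intro UnI2 CollectI exI[of _ "take i w"] exI[of _ c] exI[of _ a] exI[of _ "drop (Suc i) w"])
      (simp add: upd_conv_take_nth_drop)
  from formal.span_base[OF this] show ?thesis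
    using assms
    by (simp add: pure_tensor_def T_scale_class tensor_class_eq_iff)
qed

text \<open>
  Scalars can be absorbed into a letter, so for \<open>n > 0\<close> every tensor is a sum of pure tensors.
  Identities between additive expressions are proved with this rule by checking them on pure
  tensors.
\<close>

lemma tensor_induct [consumes 2, case_names pure add]:
  assumes n: "n > 0" and X: "X \<in> carrier (T n)"
    and pure: "\<And>w. length w = n \<Longrightarrow> P (pure w)"
    and add: "\<And>X Y. X \<in> carrier (T n) \<Longrightarrow> Y \<in> carrier (T n) \<Longrightarrow> P X \<Longrightarrow> P Y \<Longrightarrow> P (X \<oplus>\<^bsub>T n\<^esub> Y)"
  shows "P X"
proof -
  have scaled: "tensor_class sc n (Poly_Mapping.single w c) = pure (w[0 := sc c (w ! 0)])"
    if "length w = n" for w c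
    using pure_update_scale[of w n 0 c "w ! 0"] that n
    by (simp add: pure_tensor_def T_scale_class)
  from X obtain x where x: "X = tensor_class sc n x" "x \<in> formal_tensors n"
    by (auto simp: carrier_T)
  have "(\<Sum>w\<in>F. Poly_Mapping.single w (Poly_Mapping.lookup x w)) \<in> formal_tensors n
     \<and> P (tensor_class sc n (\<Sum>w\<in>F. Poly_Mapping.single w (Poly_Mapping.lookup x w)))"
    if "finite F" "F \<subseteq> Poly_Mapping.keys x" for F
    using that
  proof (induct F rule: finite_induct)
    case empty
    have "tensor_class sc n 0 = pure ((replicate n 0)[0 := sc 0 0])"
      using scaled[of "replicate n 0" 0] n by simp
    then show ?case
      using pure by simp
  next
    case (insert w F)
    have w: "length w = n"
      using insert x(2) by (auto simp: formal_tensors_def)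
    have "P (tensor_class sc n (Poly_Mapping.single w (Poly_Mapping.lookup x w))
        \<oplus>\<^bsub>T n\<^esub> tensor_class sc n (\<Sum>w\<in>F. Poly_Mapping.single w (Poly_Mapping.lookup x w)))"
      using insert w by (intro add) (simp_all add: scaled pure)
    then show ?case
      using insert w
      by (simp add: T_add_class)
  qed
  from this[of "Poly_Mapping.keys x"]
  have "P (tensor_class sc n (\<Sum>w\<in>Poly_Mapping.keys x. Poly_Mapping.single w
      (Poly_Mapping.lookup x w)))"
    by simp
  also have "(\<Sum>w\<in>Poly_Mapping.keys x. Poly_Mapping.single w (Poly_Mapping.lookup x w)) = x"
    by (rule poly_mapping_eqI)
      (simp add: lookup_sum lookup_single when_def sum.delta' in_keys_iff)
  finally show ?thesis
    by (simp add: x)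
qed

section \<open>Multilinear maps\<close>

definition multilinear :: "nat \<Rightarrow> nat \<Rightarrow> ('h list \<Rightarrow> ('h, 'k) tensor) \<Rightarrow> bool" where
  "multilinear n m f \<longleftrightarrow>
     (\<forall>w. length w = n \<longrightarrow> f w \<in> carrier (T m)) \<and>
     (\<forall>w i a b. length w = n \<longrightarrow> i < n \<longrightarrow> f (w[i := a + b]) = f (w[i := a]) \<oplus>\<^bsub>T m\<^esub> f (w[i := b])) \<and>
     (\<forall>w i c a. length w = n \<longrightarrow> i < n \<longrightarrow> f (w[i := sc c a]) = tsc m c (f (w[i := a])))"

lemma multilinearI:
  assumes "\<And>w. length w = n \<Longrightarrow> f w \<in> carrier (T m)"
    and "\<And>w i a b. length w = n \<Longrightarrow> i < n \<Longrightarrow> f (w[i := a + b]) = f (w[i := a]) \<oplus>\<^bsub>T m\<^esub> f (w[i := b])"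
    and "\<And>w i c a. length w = n \<Longrightarrow> i < n \<Longrightarrow> f (w[i := sc c a]) = tsc m c (f (w[i := a]))"
  shows "multilinear n m f"
  using assms by (simp add: multilinear_def)

lemma multilinearD:
  assumes "multilinear n m f" "length w = n"
  shows "f w \<in> carrier (T m)"
    and "i < n \<Longrightarrow> f (w[i := a + b]) = f (w[i := a]) \<oplus>\<^bsub>T m\<^esub> f (w[i := b])"
    and "i < n \<Longrightarrow> f (w[i := sc c a]) = tsc m c (f (w[i := a]))"
  using assms unfolding multilinear_def by blast+

lemma multilinear_rep:
  assumes f: "multilinear n m f"
  shows "multilinear_mod formal_scale (formal.span (multilinear_relators sc m)) n (\<lambda>w.
      tensor_rep (f w))"
proof -
  have add: "tensor_rep (X \<oplus>\<^bsub>T m\<^esub> Y) - tensor_rep X - tensor_rep Y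
      \<in> formal.span (multilinear_relators sc m)"
    if "X \<in> carrier (T m)" "Y \<in> carrier (T m)" for X Y
  proof -
    have "X \<oplus>\<^bsub>T m\<^esub> Y = tensor_class sc m (tensor_rep X + tensor_rep Y)"
      by (simp add: tensor_power_def)
    then show ?thesis
      using tensor_rep_class(2)[of "tensor_rep X + tensor_rep Y" m] that
      by (simp add: diff_diff_eq)
  qed
  have scale: "tensor_rep (tsc m c X) - formal_scale c (tensor_rep X)
      \<in> formal.span (multilinear_relators sc m)" if "X \<in> carrier (T m)" for X c
    unfolding tensor_scale_def using that by (intro tensor_rep_class) simp
  show ?thesis
    unfolding multilinear_mod_def
  proof (intro conjI allI impI)
    fix w i a b c assume w: "length (w :: 'h list) = n" and i: "i < n"
    have closed: "f (w[i := z]) \<in> carrier (T m)" for z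
      using w by (intro multilinearD(1)[OF f]) simp
    show "tensor_rep (f (w[i := a + b])) - tensor_rep (f (w[i := a])) - tensor_rep (f (w[i := b]))
        \<in> formal.span (multilinear_relators sc m)"
      unfolding multilinearD(2)[OF f w i] by (intro add closed)
    show "tensor_rep (f (w[i := sc c a])) - formal_scale c (tensor_rep (f (w[i := a])))
        \<in> formal.span (multilinear_relators sc m)"
      unfolding multilinearD(3)[OF f w i] by (intro scale closed)
  qed
qed

lemma linear_ext_rep_closed:
  assumes f: "multilinear n m f" and x: "x \<in> formal_tensors n"
  shows "linear_ext formal_scale (\<lambda>w. tensor_rep (f w)) x \<in> formal_tensors m"
  using x by (intro formal.linear_ext_in_subspace[OF subspace_formal_tensors] tensor_rep_closed
      multilinearD(1)[OF f]) (simp add: formal_tensors_def)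

lemma tensor_lift_class:
  assumes f: "multilinear n m f" and x: "x \<in> formal_tensors n"
  shows "tensor_lift sc m f (tensor_class sc n x)
    = tensor_class sc m (linear_ext formal_scale (\<lambda>w. tensor_rep (f w)) x)"
proof -
  have "linear_ext formal_scale (\<lambda>w. tensor_rep (f w)) (tensor_rep (tensor_class sc n x) - x)
      \<in> formal.span (multilinear_relators sc m)"
    by (intro linear_ext_relators[OF _ _ multilinear_rep[OF f]] tensor_rep_class x
        formal.vector_space_axioms formal.subspace_span)
  then show ?thesis
    using f x by (simp add: tensor_lift_def tensor_eval_linear_ext tensor_class_eq_iff
        linear_ext_rep_closed tensor_rep_class formal.linear_ext_diff)
qed

context
  fixes n m f
  assumes f: "multilinear n m f"
begin

lemma tensor_lift_closed: "X \<in> carrier (T n) \<Longrightarrow> tensor_lift sc m f X \<in> carrier (T m)"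
  by (auto simp: carrier_T[of n] tensor_lift_class[OF f] linear_ext_rep_closed[OF f])

lemma tensor_lift_add:
  "X \<in> carrier (T n) \<Longrightarrow> Y \<in> carrier (T n) \<Longrightarrow>
    tensor_lift sc m f (X \<oplus>\<^bsub>T n\<^esub> Y) = tensor_lift sc m f X \<oplus>\<^bsub>T m\<^esub> tensor_lift sc m f Y"
  by (auto simp: carrier_T[of n] T_add_class tensor_lift_class[OF f] linear_ext_rep_closed[OF f]
      formal.linear_ext_add)

lemma tensor_lift_scale:
  "X \<in> carrier (T n) \<Longrightarrow> tensor_lift sc m f (tsc n c X) = tsc m c (tensor_lift sc m f X)"
  by (auto simp: carrier_T[of n] T_scale_class tensor_lift_class[OF f] linear_ext_rep_closed[OF f]
      formal.linear_ext_scale)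

lemma tensor_lift_pure: "length w = n \<Longrightarrow> tensor_lift sc m f (pure w) = f w"
  using f tensor_lift_class[OF f, of "Poly_Mapping.single w 1"]
  by (simp add: pure_tensor_def multilinear_def)

end

lemma tensor_lift_cong:
  "(\<And>w. length w = n \<Longrightarrow> f w = g w) \<Longrightarrow> X \<in> carrier (T n) \<Longrightarrow>
    tensor_lift sc m f X = tensor_lift sc m g X"
  unfolding tensor_lift_def tensor_eval_linear_ext
  by (subst linear_ext_cong[of n _ "\<lambda>w. tensor_rep (g w)"]) simp_all

text \<open>
  The analogue of \<open>multilinear\<close> for functions with values in \<open>H\<close>.
\<close>

definition multilinear_form :: "nat \<Rightarrow> ('h list \<Rightarrow> 'h) \<Rightarrow> bool" where
  "multilinear_form n f \<longleftrightarrow>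
     (\<forall>w i a b. length w = n \<longrightarrow> i < n \<longrightarrow> f (w[i := a + b]) = f (w[i := a]) + f (w[i := b])) \<and>
     (\<forall>w i c a. length w = n \<longrightarrow> i < n \<longrightarrow> f (w[i := sc c a]) = sc c (f (w[i := a])))"

lemma tensor_eval_class:
  assumes f: "multilinear_form n f" and x: "x \<in> formal_tensors n"
  shows "tensor_eval sc f (tensor_class sc n x) = linear_ext sc f x"
proof -
  have "multilinear_mod sc {0} n f"
    using f by (simp add: multilinear_mod_def multilinear_form_def)
  then have "linear_ext sc f (tensor_rep (tensor_class sc n x) - x) \<in> {0}"
    using x by (rule linear_ext_relators[OF vector_space_axioms subspace_single_0 _
        tensor_rep_class(2)])
  then show ?thesis
    by (simp add: tensor_eval_linear_ext linear_ext_diff)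
qed

lemma tensor_eval_add:
  "multilinear_form n f \<Longrightarrow> X \<in> carrier (T n) \<Longrightarrow> Y \<in> carrier (T n) \<Longrightarrow>
    tensor_eval sc f (X \<oplus>\<^bsub>T n\<^esub> Y) = tensor_eval sc f X + tensor_eval sc f Y"
  by (auto simp: carrier_T T_add_class tensor_eval_class linear_ext_add)

lemma tensor_eval_pure: "multilinear_form n f \<Longrightarrow> length w = n \<Longrightarrow> tensor_eval sc f (pure w) = f w"
  by (simp add: pure_tensor_def tensor_eval_class)

section \<open>Multiplication\<close>

lemma T_scale_add:
  "X \<in> carrier (T n) \<Longrightarrow> Y \<in> carrier (T n) \<Longrightarrow> tsc n c (X \<oplus>\<^bsub>T n\<^esub> Y) = tsc n c X \<oplus>\<^bsub>T n\<^esub> tsc n c Y"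
  by (auto simp: carrier_T T_add_class T_scale_class formal.scale_right_distrib)

lemma T_scale_scale: "X \<in> carrier (T n) \<Longrightarrow> tsc n c (tsc n d X) = tsc n (c * d) X"
  by (auto simp: carrier_T T_scale_class)

lemma T_scale_left_add: "X \<in> carrier (T n) \<Longrightarrow> tsc n (c + d) X = tsc n c X \<oplus>\<^bsub>T n\<^esub> tsc n d X"
  by (auto simp: carrier_T T_scale_class T_add_class formal.scale_left_distrib)

lemma T_add_interchange:
  assumes "X \<in> carrier (T n)" "Y \<in> carrier (T n)" "Z \<in> carrier (T n)" "W \<in> carrier (T n)"
  shows "(X \<oplus>\<^bsub>T n\<^esub> Y) \<oplus>\<^bsub>T n\<^esub> (Z \<oplus>\<^bsub>T n\<^esub> W) = (X \<oplus>\<^bsub>T n\<^esub> Z) \<oplus>\<^bsub>T n\<^esub> (Y \<oplus>\<^bsub>T n\<^esub> W)"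
proof -
  interpret abelian_group "T n" by (rule T_abelian_group)
  show ?thesis using assms by (simp add: a_ac)
qed

lemma T_add_closed [simp]:
  "X \<in> carrier (T n) \<Longrightarrow> Y \<in> carrier (T n) \<Longrightarrow> X \<oplus>\<^bsub>T n\<^esub> Y \<in> carrier (T n)"
  using abelian_group.axioms(1)[OF T_abelian_group] by (rule abelian_monoid.a_closed)

text \<open>
  Partial evaluation of a function that is multilinear in two groups of letters.
\<close>

lemma multilinear_lift:
  assumes n': "n' > 0" and Y: "Y \<in> carrier (T n')"
    and l: "\<And>v. length v = n' \<Longrightarrow> multilinear n m (\<lambda>u. f u v)"
    and r: "\<And>u. length u = n \<Longrightarrow> multilinear n' m (f u)"
  shows "multilinear n m (\<lambda>u. tensor_lift sc m (f u) Y)"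
proof (rule multilinearI)
  fix w :: "'h list" and i a b c assume w: "length w = n"
  show "tensor_lift sc m (f w) Y \<in> carrier (T m)"
    by (rule tensor_lift_closed[OF r[OF w] Y])
  have w': "length (w[i := z]) = n" for z
    using w by simp
  note [simp] = tensor_lift_add[OF r[OF w']] tensor_lift_closed[OF r[OF w']]
    tensor_lift_pure[OF r[OF w']]
  assume i: "i < n"
  show "tensor_lift sc m (f (w[i := a + b])) Y
      = tensor_lift sc m (f (w[i := a])) Y \<oplus>\<^bsub>T m\<^esub> tensor_lift sc m (f (w[i := b])) Y"
    using n' Y
  proof (induct rule: tensor_induct)
    case (pure v)
    then show ?case
      using multilinearD(2)[OF l w i] by simp
  next
    case (add X Y)
    then show ?case
      by (simp add: T_add_interchange)
  qed
  show "tensor_lift sc m (f (w[i := sc c a])) Y = tsc m c (tensor_lift sc m (f (w[i := a])) Y)"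
    using n' Y
  proof (induct rule: tensor_induct)
    case (pure v)
    then show ?case
      using multilinearD(3)[OF l w i] by simp
  next
    case (add X Y)
    then show ?case
      by (simp add: T_scale_add)
  qed
qed

text \<open>
  A multilinear function may be evaluated through arbitrary representatives \<open>h\<close> of its values.
  The definition of the product uses other representatives than those picked by \<open>tensor_rep\<close>.
\<close>

lemma tensor_lift_representative:
  assumes f: "multilinear n m f" and X: "X \<in> carrier (T n)"
    and h: "\<And>w. length w = n \<Longrightarrow> h w \<in> formal_tensors m \<and> f w = tensor_class sc m (h w)"
  shows "tensor_lift sc m f X = tensor_class sc m (linear_ext formal_scale h (tensor_rep X))"
proof -
  let ?x = "tensor_rep X"
  have len: "length w = n" if "w \<in> Poly_Mapping.keys ?x" for w
    using tensor_rep_closed[OF X] that by (simp add: formal_tensors_def)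
  have "linear_ext formal_scale (\<lambda>w. tensor_rep (f w)) ?x - linear_ext formal_scale h ?x
      = linear_ext formal_scale (\<lambda>w. tensor_rep (f w) - h w) ?x"
    by (simp add: linear_ext_def formal.scale_right_diff_distrib sum_subtractf)
  also have "\<dots> \<in> formal.span (multilinear_relators sc m)"
    using h tensor_rep_class(2)
    by (intro formal.linear_ext_in_subspace formal.subspace_span) (simp add: len)
  finally show ?thesis
    unfolding tensor_lift_def tensor_eval_linear_ext using h X
    by (subst tensor_class_eq_iff)
      (auto intro: linear_ext_rep_closed[OF f]
        formal.linear_ext_in_subspace[OF subspace_formal_tensors] simp: len)
qed

lemma map2_mult_update:
  fixes u v :: "'h list"
  assumes "length u = length v" "i < length u"
  shows "map2 (*) (u[i := a]) v = (map2 (*) u v)[i := a * (v ! i)]"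
    and "map2 (*) u (v[i := a]) = (map2 (*) u v)[i := (u ! i) * a]"
  using assms by (auto intro!: nth_equalityI simp: nth_list_update)

lemma multilinear_mult:
  "length u = n \<Longrightarrow> multilinear n n (\<lambda>v. pure (map2 (*) u v))"
  "length v = n \<Longrightarrow> multilinear n n (\<lambda>u. pure (map2 (*) u v))"
  by (auto intro!: multilinearI
      simp: map2_mult_update pure_update_add pure_update_scale algebra_simps sc_mult_left
          sc_mult_right)

text \<open>
  The product is an iterated multilinear extension, so its additivity in each argument is an
  instance of the additivity of \<open>tensor_lift\<close>.
\<close>

lemma T_mult_lift:
  assumes n: "n > 0" and X: "X \<in> carrier (T n)" and Y: "Y \<in> carrier (T n)"
  shows "X \<otimes>\<^bsub>T n\<^esub> Y = tensor_lift sc n (\<lambda>u. tensor_lift sc n (\<lambda>v. pure (map2 (*) u v)) Y) X"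
proof -
  let ?x = "tensor_rep X" and ?y = "tensor_rep Y"
  let ?h = "\<lambda>u. linear_ext formal_scale (\<lambda>v. Poly_Mapping.single (map2 (*) u v) 1) ?y"
  have inner: "?h u \<in> formal_tensors n \<and>
      tensor_lift sc n (\<lambda>v. pure (map2 (*) u v)) Y = tensor_class sc n (?h u)"
    if u: "length u = n" for u
  proof
    show "?h u \<in> formal_tensors n"
      using u tensor_rep_closed[OF Y]
      by (intro formal.linear_ext_in_subspace[OF subspace_formal_tensors])
        (simp add: formal_tensors_def)
    show "tensor_lift sc n (\<lambda>v. pure (map2 (*) u v)) Y = tensor_class sc n (?h u)"
      using u by (intro tensor_lift_representative[OF multilinear_mult(1)] Y)
        (simp_all add: pure_tensor_def)
  qed
  have "X \<otimes>\<^bsub>T n\<^esub> Y = tensor_class sc n (linear_ext formal_scale ?h ?x)"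
    by (simp add: tensor_power_def Let_def linear_ext_def formal.scale_sum_right)
  also have "\<dots> = tensor_lift sc n (\<lambda>u. tensor_lift sc n (\<lambda>v. pure (map2 (*) u v)) Y) X"
    by (rule tensor_lift_representative[symmetric,
          OF multilinear_lift[OF n Y multilinear_mult(2) multilinear_mult(1)] X inner]) auto
  finally show ?thesis .
qed

lemma pure_mult:
  assumes "n > 0" "length u = n" "length v = n"
  shows "pure u \<otimes>\<^bsub>T n\<^esub> pure v = pure (map2 (*) u v)"
  using assms
  by (simp add: T_mult_lift tensor_lift_pure[OF multilinear_mult(1)]
      tensor_lift_pure[OF multilinear_lift[OF _ _ multilinear_mult(2) multilinear_mult(1)]])

lemma T_ring:
  assumes n: "n > 0"
  shows "ring (T n)"
proof (rule ringI)
  have closed: "X \<otimes>\<^bsub>T n\<^esub> Y \<in> carrier (T n)" if "X \<in> carrier (T n)" "Y \<in> carrier (T n)" for X Y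
    unfolding T_mult_lift[OF n that]
    by (rule tensor_lift_closed[OF multilinear_lift[OF n that(2) multilinear_mult(2)
        multilinear_mult(1)] that(1)])
  note [simp] = closed pure_mult[OF n]
  have l_distr: "(X \<oplus>\<^bsub>T n\<^esub> Y) \<otimes>\<^bsub>T n\<^esub> Z = (X \<otimes>\<^bsub>T n\<^esub> Z) \<oplus>\<^bsub>T n\<^esub> (Y \<otimes>\<^bsub>T n\<^esub> Z)"
    if "X \<in> carrier (T n)" "Y \<in> carrier (T n)" "Z \<in> carrier (T n)" for X Y Z
    using that
    by (simp add: T_mult_lift[OF n]
        tensor_lift_add[OF multilinear_lift[OF n that(3) multilinear_mult(2) multilinear_mult(1)]])
  have r_distr: "Z \<otimes>\<^bsub>T n\<^esub> (X \<oplus>\<^bsub>T n\<^esub> Y) = (Z \<otimes>\<^bsub>T n\<^esub> X) \<oplus>\<^bsub>T n\<^esub> (Z \<otimes>\<^bsub>T n\<^esub> Y)"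
    if X: "X \<in> carrier (T n)" and Y: "Y \<in> carrier (T n)" and Z: "Z \<in> carrier (T n)" for X Y Z
    using n Z
  proof (induct rule: tensor_induct)
    case (pure w)
    note m = tensor_lift_pure[OF multilinear_lift[OF n _ multilinear_mult(2) multilinear_mult(1)]]
    from pure X Y show ?case
      by (simp add: T_mult_lift[OF n] m tensor_lift_add[OF multilinear_mult(1)])
  next
    case (add Z W)
    then show ?case
      using X Y by (simp add: l_distr T_add_interchange)
  qed
  note [simp] = l_distr r_distr
  show "abelian_group (T n)" by (rule T_abelian_group)
  show "monoid (T n)"
  proof (rule monoidI)
    show "\<one>\<^bsub>T n\<^esub> \<in> carrier (T n)"
      by (simp add: T_one_pure)
    fix X Y Z assume X: "X \<in> carrier (T n)" and Y: "Y \<in> carrier (T n)" and Z: "Z \<in> carrier (T n)"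
    show "X \<otimes>\<^bsub>T n\<^esub> Y \<in> carrier (T n)"
      using X Y by simp
    show "X \<otimes>\<^bsub>T n\<^esub> Y \<otimes>\<^bsub>T n\<^esub> Z = X \<otimes>\<^bsub>T n\<^esub> (Y \<otimes>\<^bsub>T n\<^esub> Z)"
      using n X
    proof (induct rule: tensor_induct)
      case (pure u)
      note u = pure
      show ?case
        using n Y
      proof (induct rule: tensor_induct)
        case (pure v)
        note v = pure
        show ?case
          using n Z
        proof (induct rule: tensor_induct)
          case (pure w)
          have "map2 (*) (map2 (*) u v) w = map2 (*) u (map2 (*) v w)"
            using u v pure by (intro nth_equalityI) (simp_all add: mult.assoc)
          then show ?case
            using u v pure by simp
        qed (use u v in simp)
      qed (use u Z in simp)
    qed (use Y Z in simp)
    show "\<one>\<^bsub>T n\<^esub> \<otimes>\<^bsub>T n\<^esub> X = X"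
      using n X
    proof (induct rule: tensor_induct)
      case (pure u)
      have "map2 (*) (replicate n 1) u = u"
        using pure by (intro nth_equalityI) simp_all
      then show ?case
        using pure by (simp add: T_one_pure)
    qed (simp add: T_one_pure)
    show "X \<otimes>\<^bsub>T n\<^esub> \<one>\<^bsub>T n\<^esub> = X"
      using n X
    proof (induct rule: tensor_induct)
      case (pure u)
      have "map2 (*) u (replicate n 1) = u"
        using pure by (intro nth_equalityI) simp_all
      then show ?case
        using pure by (simp add: T_one_pure)
    qed (simp add: T_one_pure)
  qed
  fix X Y Z assume "X \<in> carrier (T n)" "Y \<in> carrier (T n)" "Z \<in> carrier (T n)"
  then show "(X \<oplus>\<^bsub>T n\<^esub> Y) \<otimes>\<^bsub>T n\<^esub> Z = (X \<otimes>\<^bsub>T n\<^esub> Z) \<oplus>\<^bsub>T n\<^esub> (Y \<otimes>\<^bsub>T n\<^esub> Z)"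
    "Z \<otimes>\<^bsub>T n\<^esub> (X \<oplus>\<^bsub>T n\<^esub> Y) = (Z \<otimes>\<^bsub>T n\<^esub> X) \<oplus>\<^bsub>T n\<^esub> (Z \<otimes>\<^bsub>T n\<^esub> Y)"
    by (rule l_distr r_distr; assumption)+
qed

lemma tensor_lift_mult:
  assumes f: "multilinear n m f" and n: "n > 0" and m: "m > 0"
    and mult: "\<And>u v. length u = n \<Longrightarrow> length v = n \<Longrightarrow> f (map2 (*) u v) = f u \<otimes>\<^bsub>T m\<^esub> f v"
    and X: "X \<in> carrier (T n)" and Y: "Y \<in> carrier (T n)"
  shows "tensor_lift sc m f (X \<otimes>\<^bsub>T n\<^esub> Y) = tensor_lift sc m f X \<otimes>\<^bsub>T m\<^esub> tensor_lift sc m f Y"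
proof -
  interpret n: ring "T n" by (rule T_ring[OF n])
  interpret m: ring "T m" by (rule T_ring[OF m])
  note [simp] = tensor_lift_add[OF f] tensor_lift_closed[OF f] tensor_lift_pure[OF f]
    multilinearD(1)[OF f]
    pure_mult[OF n] n.l_distr n.r_distr m.l_distr m.r_distr
  show ?thesis
    using n X
  proof (induct rule: tensor_induct)
    case (pure u)
    note u = pure
    show ?case
      using n Y by (induct rule: tensor_induct) (simp_all add: u mult)
  qed (simp add: Y)
qed

lemma T_scale_mult:
  assumes n: "n > 0" and X: "X \<in> carrier (T n)" and Y: "Y \<in> carrier (T n)"
  shows "tsc n c X \<otimes>\<^bsub>T n\<^esub> Y = tsc n c (X \<otimes>\<^bsub>T n\<^esub> Y)"
    and "X \<otimes>\<^bsub>T n\<^esub> tsc n c Y = tsc n c (X \<otimes>\<^bsub>T n\<^esub> Y)"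
proof -
  interpret n: ring "T n" by (rule T_ring[OF n])
  show "tsc n c X \<otimes>\<^bsub>T n\<^esub> Y = tsc n c (X \<otimes>\<^bsub>T n\<^esub> Y)"
    using X Y
    by (simp add: T_mult_lift[OF n]
        tensor_lift_scale[OF multilinear_lift[OF n Y multilinear_mult(2) multilinear_mult(1)]])
  show "X \<otimes>\<^bsub>T n\<^esub> tsc n c Y = tsc n c (X \<otimes>\<^bsub>T n\<^esub> Y)"
    using n X
  proof (induct rule: tensor_induct)
    case (pure w)
    note m = tensor_lift_pure[OF multilinear_lift[OF n _ multilinear_mult(2) multilinear_mult(1)]]
    from pure Y show ?case
      by (simp add: T_mult_lift[OF n] m tensor_lift_scale[OF multilinear_mult(1)])
  qed (simp add: Y n.l_distr T_scale_add)
qed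

section \<open>Tensor powers of low degree\<close>

lemma length_2_iff: "length w = 2 \<longleftrightarrow> (\<exists>a b. w = [a, b])"
  and length_3_iff: "length w = 3 \<longleftrightarrow> (\<exists>a b c. w = [a, b, c])"
  and length_4_iff: "length w = 4 \<longleftrightarrow> (\<exists>a b c d. w = [a, b, c, d])"
  by (auto simp: numeral_eq_Suc length_Suc_conv)

lemma replicate_2: "replicate 2 x = [x, x]"
  by (simp add: numeral_eq_Suc)

lemma tensor_induct2 [consumes 1, case_names pure add]:
  assumes "X \<in> carrier (T 2)" "\<And>a b. P (pure [a, b])"
    and "\<And>X Y. X \<in> carrier (T 2) \<Longrightarrow> Y \<in> carrier (T 2) \<Longrightarrow> P X \<Longrightarrow> P Y \<Longrightarrow> P (X \<oplus>\<^bsub>T 2\<^esub> Y)"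
  shows "P X"
  using tensor_induct[of 2 X P] assms by (auto simp: length_2_iff)

lemma tensor_induct3 [consumes 1, case_names pure add]:
  assumes "X \<in> carrier (T 3)" "\<And>a b c. P (pure [a, b, c])"
    and "\<And>X Y. X \<in> carrier (T 3) \<Longrightarrow> Y \<in> carrier (T 3) \<Longrightarrow> P X \<Longrightarrow> P Y \<Longrightarrow> P (X \<oplus>\<^bsub>T 3\<^esub> Y)"
  shows "P X"
  using tensor_induct[of 3 X P] assms by (auto simp: length_3_iff)

lemma tensor_induct4 [consumes 1, case_names pure add]:
  assumes "X \<in> carrier (T 4)" "\<And>a b c d. P (pure [a, b, c, d])"
    and "\<And>X Y. X \<in> carrier (T 4) \<Longrightarrow> Y \<in> carrier (T 4) \<Longrightarrow> P X \<Longrightarrow> P Y \<Longrightarrow> P (X \<oplus>\<^bsub>T 4\<^esub> Y)"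
  shows "P X"
  using tensor_induct[of 4 X P] assms by (auto simp: length_4_iff)

lemmas low_degree_rings = T_ring[of 2, simplified] T_ring[of 3, simplified] T_ring[of 4, simplified]

lemma pure_closed_low [simp]:
  "pure [a, b] \<in> carrier (T 2)" "pure [a, b, c] \<in> carrier (T 3)" "pure [a, b, c, d] \<in> carrier (T 4)"
  by simp_all

lemma pure_mult_low [simp]:
  "pure [a, b] \<otimes>\<^bsub>T 2\<^esub> pure [a', b'] = pure [a * a', b * b']"
  "pure [a, b, c] \<otimes>\<^bsub>T 3\<^esub> pure [a', b', c'] = pure [a * a', b * b', c * c']"
  "pure [a, b, c, d] \<otimes>\<^bsub>T 4\<^esub> pure [a', b', c', d'] = pure [a * a', b * b', c * c', d * d']"
  by (simp_all add: pure_mult)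

lemma one_low:
  "\<one>\<^bsub>T 2\<^esub> = pure [1, 1]" "\<one>\<^bsub>T 3\<^esub> = pure [1, 1, 1]" "\<one>\<^bsub>T 4\<^esub> = pure [1, 1, 1, 1]"
  by (simp_all add: T_one_pure numeral_eq_Suc)

lemma pure_add_low:
  "pure [a + a', b] = pure [a, b] \<oplus>\<^bsub>T 2\<^esub> pure [a', b]"
  "pure [a, b + b'] = pure [a, b] \<oplus>\<^bsub>T 2\<^esub> pure [a, b']"
  "pure [a + a', b, c] = pure [a, b, c] \<oplus>\<^bsub>T 3\<^esub> pure [a', b, c]"
  "pure [a, b + b', c] = pure [a, b, c] \<oplus>\<^bsub>T 3\<^esub> pure [a, b', c]"
  "pure [a, b, c + c'] = pure [a, b, c] \<oplus>\<^bsub>T 3\<^esub> pure [a, b, c']"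
  "pure [a + a', b, c, d] = pure [a, b, c, d] \<oplus>\<^bsub>T 4\<^esub> pure [a', b, c, d]"
  "pure [a, b + b', c, d] = pure [a, b, c, d] \<oplus>\<^bsub>T 4\<^esub> pure [a, b', c, d]"
  "pure [a, b, c + c', d] = pure [a, b, c, d] \<oplus>\<^bsub>T 4\<^esub> pure [a, b, c', d]"
  "pure [a, b, c, d + d'] = pure [a, b, c, d] \<oplus>\<^bsub>T 4\<^esub> pure [a, b, c, d']"
  using pure_update_add[of "[a, b]" 2 0 a a'] pure_update_add[of "[a, b]" 2 1 b b']
    pure_update_add[of "[a, b, c]" 3 0 a a'] pure_update_add[of "[a, b, c]" 3 1 b b']
    pure_update_add[of "[a, b, c]" 3 2 c c']
    pure_update_add[of "[a, b, c, d]" 4 0 a a'] pure_update_add[of "[a, b, c, d]" 4 1 b b']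
    pure_update_add[of "[a, b, c, d]" 4 2 c c'] pure_update_add[of "[a, b, c, d]" 4 3 d d']
  by (simp_all add: numeral_eq_Suc)

lemma pure_scale_low:
  "pure [sc e a, b] = tsc 2 e (pure [a, b])"
  "pure [a, sc e b] = tsc 2 e (pure [a, b])"
  "pure [sc e a, b, c] = tsc 3 e (pure [a, b, c])"
  "pure [a, sc e b, c] = tsc 3 e (pure [a, b, c])"
  "pure [a, b, sc e c] = tsc 3 e (pure [a, b, c])"
  "pure [sc e a, b, c, d] = tsc 4 e (pure [a, b, c, d])"
  "pure [a, sc e b, c, d] = tsc 4 e (pure [a, b, c, d])"
  "pure [a, b, sc e c, d] = tsc 4 e (pure [a, b, c, d])"
  "pure [a, b, c, sc e d] = tsc 4 e (pure [a, b, c, d])"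
  using pure_update_scale[of "[a, b]" 2 0 e a] pure_update_scale[of "[a, b]" 2 1 e b]
    pure_update_scale[of "[a, b, c]" 3 0 e a] pure_update_scale[of "[a, b, c]" 3 1 e b]
    pure_update_scale[of "[a, b, c]" 3 2 e c]
    pure_update_scale[of "[a, b, c, d]" 4 0 e a] pure_update_scale[of "[a, b, c, d]" 4 1 e b]
    pure_update_scale[of "[a, b, c, d]" 4 2 e c] pure_update_scale[of "[a, b, c, d]" 4 3 e d]
  by (simp_all add: numeral_eq_Suc)

lemma less_low: "i < (2::nat) \<longleftrightarrow> i = 0 \<or> i = 1" "i < (3::nat) \<longleftrightarrow> i = 0 \<or> i = 1 \<or> i = 2"
  "i < (4::nat) \<longleftrightarrow> i = 0 \<or> i = 1 \<or> i = 2 \<or> i = 3"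
  by auto

lemma multilinear2I:
  assumes "\<And>a b. f [a, b] \<in> carrier (T m)"
    and "\<And>a a' b. f [a + a', b] = f [a, b] \<oplus>\<^bsub>T m\<^esub> f [a', b]"
    and "\<And>a b b'. f [a, b + b'] = f [a, b] \<oplus>\<^bsub>T m\<^esub> f [a, b']"
    and "\<And>e a b. f [sc e a, b] = tsc m e (f [a, b])"
    and "\<And>e a b. f [a, sc e b] = tsc m e (f [a, b])"
  shows "multilinear 2 m f"
  by (rule multilinearI) (auto simp: length_2_iff less_low assms)

lemma multilinear3I:
  assumes "\<And>a b c. f [a, b, c] \<in> carrier (T m)"
    and "\<And>a a' b c. f [a + a', b, c] = f [a, b, c] \<oplus>\<^bsub>T m\<^esub> f [a', b, c]"
    and "\<And>a b b' c. f [a, b + b', c] = f [a, b, c] \<oplus>\<^bsub>T m\<^esub> f [a, b', c]"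
    and "\<And>a b c c'. f [a, b, c + c'] = f [a, b, c] \<oplus>\<^bsub>T m\<^esub> f [a, b, c']"
    and "\<And>e a b c. f [sc e a, b, c] = tsc m e (f [a, b, c])"
    and "\<And>e a b c. f [a, sc e b, c] = tsc m e (f [a, b, c])"
    and "\<And>e a b c. f [a, b, sc e c] = tsc m e (f [a, b, c])"
  shows "multilinear 3 m f"
  by (rule multilinearI) (auto simp: length_3_iff less_low assms)

lemma multilinear4I:
  assumes "\<And>a b c d. f [a, b, c, d] \<in> carrier (T m)"
    and "\<And>a a' b c d. f [a + a', b, c, d] = f [a, b, c, d] \<oplus>\<^bsub>T m\<^esub> f [a', b, c, d]"
    and "\<And>a b b' c d. f [a, b + b', c, d] = f [a, b, c, d] \<oplus>\<^bsub>T m\<^esub> f [a, b', c, d]"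
    and "\<And>a b c c' d. f [a, b, c + c', d] = f [a, b, c, d] \<oplus>\<^bsub>T m\<^esub> f [a, b, c', d]"
    and "\<And>a b c d d'. f [a, b, c, d + d'] = f [a, b, c, d] \<oplus>\<^bsub>T m\<^esub> f [a, b, c, d']"
    and "\<And>e a b c d. f [sc e a, b, c, d] = tsc m e (f [a, b, c, d])"
    and "\<And>e a b c d. f [a, sc e b, c, d] = tsc m e (f [a, b, c, d])"
    and "\<And>e a b c d. f [a, b, sc e c, d] = tsc m e (f [a, b, c, d])"
    and "\<And>e a b c d. f [a, b, c, sc e d] = tsc m e (f [a, b, c, d])"
  shows "multilinear 4 m f"
  by (rule multilinearI) (auto simp: length_4_iff less_low assms numeral_3_eq_3)

lemma multilinear_form2I:
  assumes "\<And>a a' b. f [a + a', b] = f [a, b] + f [a', b]"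
    and "\<And>a b b'. f [a, b + b'] = f [a, b] + f [a, b']"
    and "\<And>e a b. f [sc e a, b] = sc e (f [a, b])"
    and "\<And>e a b. f [a, sc e b] = sc e (f [a, b])"
  shows "multilinear_form 2 f"
  unfolding multilinear_form_def by (auto simp: length_2_iff less_low assms)

lemmas multilinear_simps = pure_add_low pure_scale_low distrib_left distrib_right
  sc_mult_left sc_mult_right

sublocale T2: ring "T 2" by (rule low_degree_rings)
sublocale T3: ring "T 3" by (rule low_degree_rings)
sublocale T4: ring "T 4" by (rule low_degree_rings)

lemmas T_distr = T2.l_distr T2.r_distr T3.l_distr T3.r_distr T4.l_distr T4.r_distr

lemma multilinear_sandwich:
  assumes g: "multilinear n m g" and m: "m > 0"
    and P: "P \<in> carrier (T m)" and R: "R \<in> carrier (T m)"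
  shows "multilinear n m (\<lambda>w. P \<otimes>\<^bsub>T m\<^esub> g w \<otimes>\<^bsub>T m\<^esub> R)"
proof -
  interpret T: ring "T m" by (rule T_ring[OF m])
  show ?thesis
    by (rule multilinearI)
      (simp_all add: P R multilinearD[OF g] T.l_distr T.r_distr T_scale_mult[OF m])
qed

lemma tensor_lift_sandwich:
  assumes g: "multilinear n m g" and m: "m > 0" and n: "n > 0"
    and P: "P \<in> carrier (T m)" and R: "R \<in> carrier (T m)" and X: "X \<in> carrier (T n)"
  shows "tensor_lift sc m (\<lambda>w. P \<otimes>\<^bsub>T m\<^esub> g w \<otimes>\<^bsub>T m\<^esub> R) X = P \<otimes>\<^bsub>T m\<^esub> tensor_lift sc m g X \<otimes>\<^bsub>T m\<^esub> R"
proof -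
  interpret T: ring "T m" by (rule T_ring[OF m])
  note ml = multilinear_sandwich[OF g m P R]
  show ?thesis
    using n X
    by (induct rule: tensor_induct)
      (simp_all add: P R tensor_lift_pure[OF ml] tensor_lift_pure[OF g] tensor_lift_add[OF ml]
        tensor_lift_add[OF g] tensor_lift_closed[OF g] T.l_distr T.r_distr)
qed

section \<open>Placing a tensor in chosen factors\<close>

abbreviation times2 (infixl "\<otimes>\<^sub>2" 70) where "X \<otimes>\<^sub>2 Y \<equiv> X \<otimes>\<^bsub>T 2\<^esub> Y"
abbreviation plus2 (infixl "\<oplus>\<^sub>2" 65) where "X \<oplus>\<^sub>2 Y \<equiv> X \<oplus>\<^bsub>T 2\<^esub> Y"
abbreviation times3 (infixl "\<otimes>\<^sub>3" 70) where "X \<otimes>\<^sub>3 Y \<equiv> X \<otimes>\<^bsub>T 3\<^esub> Y"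
abbreviation plus3 (infixl "\<oplus>\<^sub>3" 65) where "X \<oplus>\<^sub>3 Y \<equiv> X \<oplus>\<^bsub>T 3\<^esub> Y"
abbreviation times4 (infixl "\<otimes>\<^sub>4" 70) where "X \<otimes>\<^sub>4 Y \<equiv> X \<otimes>\<^bsub>T 4\<^esub> Y"
abbreviation plus4 (infixl "\<oplus>\<^sub>4" 65) where "X \<oplus>\<^sub>4 Y \<equiv> X \<oplus>\<^bsub>T 4\<^esub> Y"

text \<open>
  A multilinear map that is multiplicative on words induces a ring homomorphism. The embeddings
  of tensors into chosen factors and the coproduct on a factor arise in this way, so they
  preserve the inverses occurring later.
\<close>

lemma tensor_lift_ring_hom:
  assumes "multilinear n m f" "n > 0" "m > 0"
    and "\<And>u v. length u = n \<Longrightarrow> length v = n \<Longrightarrow> f (map2 (*) u v) = f u \<otimes>\<^bsub>T m\<^esub> f v"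
    and "f (replicate n 1) = \<one>\<^bsub>T m\<^esub>"
  shows "tensor_lift sc m f \<in> ring_hom (T n) (T m)"
  using assms
  by (intro ring_hom_memI)
    (simp_all add: tensor_lift_closed tensor_lift_add tensor_lift_mult
        tensor_lift_pure T_one_pure[of n])

lemma multilinear_one_right: "multilinear n (n + 1) (\<lambda>w. pure (w @ [1]))"
  using pure_update_add[of "_ @ [1]" "n + 1"] pure_update_scale[of "_ @ [1]" "n + 1"]
  by (auto intro!: multilinearI simp flip: list_update_append1)

lemma multilinear_one_left: "multilinear n (n + 1) (\<lambda>w. pure (1 # w))"
  using pure_update_add[of "1 # _" "n + 1" "Suc _"] pure_update_scale[of "1 # _" "n + 1" "Suc _"]
  by (auto intro!: multilinearI)

lemma one_right_ring_hom: "n > 0 \<Longrightarrow> tensor_one_right sc n \<in> ring_hom (T n) (T (n + 1))"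
  unfolding tensor_one_right_def[abs_def]
  by (rule tensor_lift_ring_hom[OF multilinear_one_right])
    (simp_all add: pure_mult T_one_pure replicate_append_same)

lemma one_left_ring_hom: "n > 0 \<Longrightarrow> tensor_one_left sc n \<in> ring_hom (T n) (T (n + 1))"
  unfolding tensor_one_left_def[abs_def]
  by (rule tensor_lift_ring_hom[OF multilinear_one_left]) (simp_all add: pure_mult T_one_pure)

lemma one_right_pure [simp]: "length w = n \<Longrightarrow> tensor_one_right sc n (pure w) = pure (w @ [1])"
  by (simp add: tensor_one_right_def tensor_lift_pure[OF multilinear_one_right] del: One_nat_def)

lemma one_left_pure [simp]: "length w = n \<Longrightarrow> tensor_one_left sc n (pure w) = pure (1 # w)"
  by (simp add: tensor_one_left_def tensor_lift_pure[OF multilinear_one_left] del: One_nat_def)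

text \<open>
  The outer pair of factors, which \<open>a \<beta> S(d)\<close> and \<open>S(a) \<alpha> d\<close> join in the formulas for \<open>\<gamma>\<close>.
\<close>

definition leg14 :: "('h, 'k) tensor \<Rightarrow> ('h, 'k) tensor" where
  "leg14 = tensor_lift sc 4 (\<lambda>w. pure [w ! 0, 1, 1, w ! 1])"

lemma multilinear_leg14: "multilinear 2 4 (\<lambda>w. pure [w ! 0, 1, 1, w ! 1])"
  by (rule multilinear2I) (simp_all add: multilinear_simps)

lemma leg14_ring_hom: "leg14 \<in> ring_hom (T 2) (T 4)"
  unfolding leg14_def
  by (rule tensor_lift_ring_hom[OF multilinear_leg14])
    (auto simp: length_2_iff one_low replicate_2)

lemma leg14_pure [simp]: "leg14 (pure [a, b]) = pure [a, 1, 1, b]"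
  using tensor_lift_pure[OF multilinear_leg14] by (simp add: leg14_def)

lemma multilinear_flip: "multilinear 2 2 (\<lambda>w. pure [w ! 1, w ! 0])"
  by (rule multilinear2I) (simp_all add: multilinear_simps)

lemma flip_pure [simp]: "tensor_flip sc (pure [a, b]) = pure [b, a]"
  using tensor_lift_pure[OF multilinear_flip] by (simp add: tensor_flip_def)

end

section \<open>The coproduct on a tensor factor\<close>

sublocale quasi_bialgebra \<subseteq> k_algebra "scal Q"
  by (rule algebra)

context quasi_bialgebra
begin

notation times2 (infixl "\<otimes>\<^sub>2" 70)
notation plus2 (infixl "\<oplus>\<^sub>2" 65)
notation times3 (infixl "\<otimes>\<^sub>3" 70)
notation plus3 (infixl "\<oplus>\<^sub>3" 65)
notation times4 (infixl "\<otimes>\<^sub>4" 70)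
notation plus4 (infixl "\<oplus>\<^sub>4" 65)

abbreviation splice :: "nat \<Rightarrow> 'h list \<Rightarrow> 'h list \<Rightarrow> 'h list" where
  "splice i w u \<equiv> take i w @ u @ drop (Suc i) w"

lemma splice_update_right:
  "i < length w \<Longrightarrow> j < length u \<Longrightarrow> splice i w (u[j := a]) = (splice i w u)[i + j := a]"
  by (simp add: list_update_append)

lemma splice_update_left:
  assumes "i < length w" "j < length w"
  shows "splice i (w[j := a]) u =
    (if j = i then splice i w u
     else (splice i w u)[if j < i then j else length u + j - 1 := a])"
proof -
  consider "j < i" | "j = i" | "i < j" by linarith
  then show ?thesis
  proof cases
    case 3
    then have "drop (Suc i) (w[j := a]) = (drop (Suc i) w)[j - Suc i := a]"
      using assms by (simp add: drop_update_swap)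
    with 3 assms show ?thesis
      by (auto simp: list_update_append)
  next
    case 1
    with assms show ?thesis
      by (simp add: list_update_append take_update_swap)
  qed (use assms in simp)
qed

lemma multilinear_splice:
  "length w = n \<Longrightarrow> i < n \<Longrightarrow> multilinear 2 (n + 1) (\<lambda>u. pure (splice i w u))"
  by (rule multilinearI) (simp_all only: splice_update_right, simp_all add: pure_update_add
      pure_update_scale)

text \<open>
  Changing the letter with index \<open>i\<close> changes only the tensor that is spliced in, where linearity
  of \<open>\<Delta>\<close> applies; changing another letter changes the words into which it is spliced, at a
  position that is shifted by one if it lies to the right of \<open>i\<close>.
\<close>

lemma multilinear_comult_at:
  assumes i: "i < n"
  shows "multilinear n (n + 1)
    (\<lambda>w. tensor_lift (scal Q) (n + 1) (\<lambda>u. pure (splice i w u)) (comult Q (w ! i)))"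
proof (rule multilinearI)
  fix w :: "'h list" and j a b c assume w: "length w = n"
  note ml = multilinear_splice[OF _ i]
  show "tensor_lift (scal Q) (n + 1) (\<lambda>u. pure (splice i w u))
      (comult Q (w ! i)) \<in> carrier (T (n + 1))"
    by (rule tensor_lift_closed[OF ml[OF w] comult_closed])
  assume j: "j < n"
  note [simp] = tensor_lift_closed[OF ml] tensor_lift_add[OF ml] tensor_lift_scale[OF ml]
    tensor_lift_pure[OF ml] comult_closed comult_add comult_scal T_add_interchange T_scale_add
  let ?k = "if j < i then j else Suc j"
  have upd: "splice i (w[j := z]) u = (splice i w u)[?k := z]" if "j \<noteq> i" "length u = 2" for z u
    using that w i j by (subst splice_update_left) auto
  have "tensor_lift (scal Q) (n + 1) (\<lambda>u. pure (splice i (w[j := a + b]) u)) D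
      = tensor_lift (scal Q) (n + 1) (\<lambda>u. pure (splice i (w[j := a]) u)) D \<oplus>\<^bsub>T (n + 1)\<^esub>
        tensor_lift (scal Q) (n + 1) (\<lambda>u. pure (splice i (w[j := b]) u)) D
     \<and> tensor_lift (scal Q) (n + 1) (\<lambda>u. pure (splice i (w[j := scal Q c a]) u)) D
      = tsc (n + 1) c (tensor_lift (scal Q) (n + 1) (\<lambda>u. pure (splice i (w[j := a]) u)) D)"
    if "j \<noteq> i" and D: "D \<in> carrier (T 2)" for D
    using D
  proof (induct rule: tensor_induct2)
    case (pure x y)
    note [simp del] = One_nat_def
    note p = pure_update_add[of "splice i w [x, y]" "n + 1" ?k]
      pure_update_scale[of "splice i w [x, y]" "n + 1" ?k]
    show ?case
      using p w i j upd[OF \<open>j \<noteq> i\<close>, of "[x, y]"] by simp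
  next
    case (add X Y)
    then show ?case
      using w by (simp del: One_nat_def)
  qed
  with w i show "tensor_lift (scal Q) (n + 1) (\<lambda>u. pure (splice i (w[j := a + b]) u))
      (comult Q (w[j := a + b] ! i))
      = tensor_lift (scal Q) (n + 1) (\<lambda>u. pure (splice i (w[j := a]) u))
          (comult Q (w[j := a] ! i)) \<oplus>\<^bsub>T (n + 1)\<^esub>
        tensor_lift (scal Q) (n + 1) (\<lambda>u. pure (splice i (w[j := b]) u)) (comult Q (w[j := b] ! i))"
   and "tensor_lift (scal Q) (n + 1) (\<lambda>u. pure (splice i (w[j := scal Q c a]) u))
       (comult Q (w[j := scal Q c a] ! i))
      = tsc (n + 1) c (tensor_lift (scal Q) (n + 1) (\<lambda>u. pure (splice i (w[j := a]) u))
          (comult Q (w[j := a] ! i)))"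
    by (cases "j = i"; simp del: One_nat_def)+
qed

lemma comult_at_pure:
  "i < n \<Longrightarrow> length w = n \<Longrightarrow> comult_at Q n i (pure w) =
    tensor_lift (scal Q) (n + 1) (\<lambda>u. pure (splice i w u)) (comult Q (w ! i))"
  by (simp add: comult_at_def tensor_lift_pure[OF multilinear_comult_at] del: One_nat_def)

lemma splice_mult:
  assumes "length u = length u'" "length w = length w'" "i < length w"
  shows "map2 (*) (splice i w u) (splice i w' u') = splice i (map2 (*) w w') (map2 (*) u u')"
  using assms by (simp add: take_map take_zip drop_map drop_zip)

lemma comult_at_ring_hom:
  assumes i: "i < n"
  shows "comult_at Q n i \<in> ring_hom (T n) (T (n + 1))"
  unfolding comult_at_def[abs_def]
proof (rule tensor_lift_ring_hom[OF multilinear_comult_at[OF i]])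
  note ml = multilinear_splice[OF _ i]
  note [simp del] = One_nat_def
  interpret S: ring "T (n + 1)" by (rule T_ring) simp
  note [simp] = tensor_lift_closed[OF ml] tensor_lift_add[OF ml] tensor_lift_pure[OF ml]
    S.l_distr S.r_distr T2.l_distr T2.r_distr
  fix u v :: "'h list" assume u: "length u = n" and v: "length v = n"
  have "tensor_lift (scal Q) (n + 1) (\<lambda>x. pure (splice i (map2 (*) u v) x)) (D \<otimes>\<^sub>2 E)
      = tensor_lift (scal Q) (n + 1) (\<lambda>x. pure (splice i u x)) D \<otimes>\<^bsub>T (n + 1)\<^esub>
        tensor_lift (scal Q) (n + 1) (\<lambda>x. pure (splice i v x)) E"
    if D: "D \<in> carrier (T 2)" and E: "E \<in> carrier (T 2)" for D E
    using D
  proof (induct rule: tensor_induct2)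
    case (pure a b)
    show ?case
      using E
    proof (induct rule: tensor_induct2)
      case (pure a' b')
      then show ?case
        using u v i splice_mult[of "[a, b]" "[a', b']" u v i] by (simp add: pure_mult)
    qed (use u v i in simp)
  qed (use u v i E in simp)
  then show "tensor_lift (scal Q) (n + 1) (\<lambda>x. pure (splice i (map2 (*) u v) x))
      (comult Q (map2 (*) u v ! i))
      = tensor_lift (scal Q) (n + 1) (\<lambda>x. pure (splice i u x)) (comult Q (u ! i)) \<otimes>\<^bsub>T (n + 1)\<^esub>
        tensor_lift (scal Q) (n + 1) (\<lambda>x. pure (splice i v x)) (comult Q (v ! i))"
    using u v i by (simp add: comult_mult comult_closed)
next
  note [simp del] = One_nat_def
  have "splice i (replicate n 1) [1, 1] = replicate (n + 1) (1 :: 'h)"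
    using i by (intro nth_equalityI) (auto simp: nth_append nth_Cons split: nat.split)
  then show "tensor_lift (scal Q) (n + 1) (\<lambda>x. pure (splice i (replicate n 1) x))
      (comult Q (replicate n 1 ! i))
      = \<one>\<^bsub>T (n + 1)\<^esub>"
    using i tensor_lift_pure[OF multilinear_splice[OF _ i, of "replicate n 1"], of "[1, 1]"]
    by (simp add: comult_one T_one_pure replicate_2)
qed (use i in simp_all)

abbreviation Phi :: "('h, 'k) tensor" where "Phi \<equiv> reassoc Q"
abbreviation Phi_inv :: "('h, 'k) tensor" where "Phi_inv \<equiv> inv\<^bsub>T 3\<^esub> reassoc Q"

text \<open>
  The indices name the factors that receive the tensor: \<open>e12\<close> and \<open>e23\<close> map \<open>H \<otimes> H\<close> into the
  third tensor power, \<open>e123\<close> and \<open>e234\<close> map the third into the fourth one.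
\<close>

abbreviation e12 :: "('h, 'k) tensor \<Rightarrow> ('h, 'k) tensor" where "e12 \<equiv> tensor_one_right (scal Q) 2"
abbreviation e23 :: "('h, 'k) tensor \<Rightarrow> ('h, 'k) tensor" where "e23 \<equiv> tensor_one_left (scal Q) 2"
abbreviation e123 :: "('h, 'k) tensor \<Rightarrow> ('h, 'k) tensor" where "e123 \<equiv> tensor_one_right (scal Q) 3"
abbreviation e234 :: "('h, 'k) tensor \<Rightarrow> ('h, 'k) tensor" where "e234 \<equiv> tensor_one_left (scal Q) 3"

definition counit_middle :: "('h, 'k) tensor \<Rightarrow> ('h, 'k) tensor" where
  "counit_middle = tensor_lift (scal Q) 2
     (\<lambda>w. pure [scal Q (counit Q (w ! 1)) (w ! 0), w ! 2])"

lemma multilinear_counit_middle: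
  "multilinear 3 2 (\<lambda>w. pure [scal Q (counit Q (w ! 1)) (w ! 0), w ! 2])"
  by (rule multilinear3I)
    (simp_all add: counit_add counit_scal multilinear_simps T_scale_left_add T_scale_add
        T_scale_scale
      mult.commute)

lemma counit_middle_ring_hom: "counit_middle \<in> ring_hom (T 3) (T 2)"
  unfolding counit_middle_def
  by (rule tensor_lift_ring_hom[OF multilinear_counit_middle])
    (auto simp: length_3_iff one_low counit_mult counit_one sc_mult_left sc_mult_right mult.commute
      numeral_3_eq_3)

lemma counit_middle_pure [simp]: "counit_middle (pure [a, b, c]) = pure [scal Q (counit Q b) a, c]"
  using tensor_lift_pure[OF multilinear_counit_middle] by (simp add: counit_middle_def)

lemmas leg_homs =
  one_right_ring_hom[of 2, simplified] one_left_ring_hom[of 2, simplified]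
  one_right_ring_hom[of 3, simplified] one_left_ring_hom[of 3, simplified]
  leg14_ring_hom counit_middle_ring_hom
  comult_at_ring_hom[of 0 2, simplified] comult_at_ring_hom[of 1 2, simplified]
  comult_at_ring_hom[of 0 3, simplified] comult_at_ring_hom[of 1 3, simplified]

lemmas hom_simps [simp] = leg_homs[THEN ring_hom_closed] leg_homs[THEN ring_hom_add]
  leg_homs[THEN ring_hom_one]

lemmas hom_mult = leg_homs[THEN ring_hom_mult]

declare comult_closed [simp]

lemma reassoc_closed [simp]:
  "Phi \<in> carrier (T 3)" "Phi_inv \<in> carrier (T 3)"
  using reassoc_unit by auto

lemma lift_splice:
  assumes "D \<in> carrier (T 2)"
  shows "tensor_lift (scal Q) 3 (\<lambda>u. pure (u @ [b])) D = e12 D \<otimes>\<^sub>3 pure [1, 1, b]"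
    and "tensor_lift (scal Q) 3 (\<lambda>u. pure (a # u)) D = pure [a, 1, 1] \<otimes>\<^sub>3 e23 D"
    and "tensor_lift (scal Q) 4 (\<lambda>u. pure (u @ [b, c])) D = e123 (e12 D) \<otimes>\<^sub>4 pure [1, 1, b, c]"
    and "tensor_lift (scal Q) 4 (\<lambda>u. pure (a # u @ [c])) D = pure [a, 1, 1, c] \<otimes>\<^sub>4 e123 (e23 D)"
proof -
  note ml = multilinear_splice[of "[a, b]" 2 0, simplified]
      multilinear_splice[of "[a, b]" 2 1, simplified]
    multilinear_splice[of "[a, b, c]" 3 0, simplified]
        multilinear_splice[of "[a, b, c]" 3 1, simplified]
  note [simp] = ml[THEN tensor_lift_add] ml[THEN tensor_lift_pure] T_distr
  show "tensor_lift (scal Q) 3 (\<lambda>u. pure (u @ [b])) D = e12 D \<otimes>\<^sub>3 pure [1, 1, b]"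
    "tensor_lift (scal Q) 3 (\<lambda>u. pure (a # u)) D = pure [a, 1, 1] \<otimes>\<^sub>3 e23 D"
    "tensor_lift (scal Q) 4 (\<lambda>u. pure (u @ [b, c])) D = e123 (e12 D) \<otimes>\<^sub>4 pure [1, 1, b, c]"
    "tensor_lift (scal Q) 4 (\<lambda>u. pure (a # u @ [c])) D = pure [a, 1, 1, c] \<otimes>\<^sub>4 e123 (e23 D)"
    using assms by (induct rule: tensor_induct2; simp)+
qed

text \<open>
  A coproduct on a factor of a pure tensor is the product of an embedded coproduct with a pure
  tensor supported on the other factors. This moves computations with coproducts into the rings.
\<close>

lemma comult_at_pure_legs:
  "comult_at Q 2 0 (pure [a, b]) = e12 (comult Q a) \<otimes>\<^sub>3 pure [1, 1, b]"
  "comult_at Q 2 (Suc 0) (pure [a, b]) = pure [a, 1, 1] \<otimes>\<^sub>3 e23 (comult Q b)"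
  "comult_at Q 3 0 (pure [a, b, c]) = e123 (e12 (comult Q a)) \<otimes>\<^sub>4 pure [1, 1, b, c]"
  "comult_at Q 3 (Suc 0) (pure [a, b, c]) = pure [a, 1, 1, c] \<otimes>\<^sub>4 e123 (e23 (comult Q b))"
  by (simp_all add: comult_at_pure lift_splice)

lemma leg_commute:
  "X \<in> carrier (T 2) \<Longrightarrow> pure [1, 1, a] \<otimes>\<^sub>3 e12 X = e12 X \<otimes>\<^sub>3 pure [1, 1, a]"
  "X \<in> carrier (T 2) \<Longrightarrow> pure [a, 1, 1] \<otimes>\<^sub>3 e23 X = e23 X \<otimes>\<^sub>3 pure [a, 1, 1]"
  "X \<in> carrier (T 2) \<Longrightarrow> pure [1, 1, a, b] \<otimes>\<^sub>4 e123 (e12 X) = e123 (e12 X) \<otimes>\<^sub>4 pure [1, 1, a, b]"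
  "X \<in> carrier (T 2) \<Longrightarrow> pure [a, 1, 1, b] \<otimes>\<^sub>4 e123 (e23 X) = e123 (e23 X) \<otimes>\<^sub>4 pure [a, 1, 1, b]"
  by (induct X rule: tensor_induct2; simp add: T_distr)+

lemma leg_commute3:
  "X \<in> carrier (T 3) \<Longrightarrow> pure [1, 1, 1, a] \<otimes>\<^sub>4 e123 X = e123 X \<otimes>\<^sub>4 pure [1, 1, 1, a]"
  by (induct X rule: tensor_induct3; simp add: T_distr)

lemma leg12_leg34_commute:
  assumes "X \<in> carrier (T 2)" "Y \<in> carrier (T 2)"
  shows "e123 (e12 X) \<otimes>\<^sub>4 e234 (e23 Y) = e234 (e23 Y) \<otimes>\<^sub>4 e123 (e12 X)"
  using assms(2)
proof (induct rule: tensor_induct2)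
  case (pure a b)
  then show ?case using assms(1) by (simp add: leg_commute)
qed (use assms(1) in \<open>simp add: T_distr\<close>)

text \<open>
  The coproduct acts on the factors occupied by an embedded tensor as it acts before embedding,
  and trivially on a factor \<open>1\<close>.
\<close>

lemma comult_at_legs:
  assumes "X \<in> carrier (T 2)"
  shows "comult_at Q 3 0 (e12 X) = e123 (comult_at Q 2 0 X)"
    and "comult_at Q 3 0 (e23 X) = e234 (e23 X)"
    and "comult_at Q 3 (Suc 0) (e12 X) = e123 (comult_at Q 2 (Suc 0) X)"
proof -
  note [simp] = comult_at_pure_legs hom_mult comult_one
  show "comult_at Q 3 0 (e12 X) = e123 (comult_at Q 2 0 X)"
    using assms by (induct X rule: tensor_induct2) simp_all
  show "comult_at Q 3 0 (e23 X) = e234 (e23 X)"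
    using assms by (induct X rule: tensor_induct2) simp_all
  show "comult_at Q 3 (Suc 0) (e12 X) = e123 (comult_at Q 2 (Suc 0) X)"
    using assms by (induct X rule: tensor_induct2) simp_all
qed

lemma comult_at_last: "comult_at Q 3 0 (pure [1, 1, b]) = pure [1, 1, 1, b]"
    "comult_at Q 3 (Suc 0) (pure [1, 1, b]) = pure [1, 1, 1, b]"
  by (simp_all add: comult_at_pure_legs comult_one)

section \<open>Quasi-coassociativity and the counit\<close>

text \<open>
  Quasi-coassociativity as commutation rules for \<open>\<Phi>\<close> and \<open>\<Phi>\<^sup>-\<^sup>1\<close>.
\<close>

lemma comult_reassoc:
  "comult_at Q 2 0 (comult Q a) \<otimes>\<^sub>3 Phi = Phi \<otimes>\<^sub>3 comult_at Q 2 (Suc 0) (comult Q a)"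
  "comult_at Q 2 (Suc 0) (comult Q a) \<otimes>\<^sub>3 Phi_inv
    = Phi_inv \<otimes>\<^sub>3 comult_at Q 2 0 (comult Q a)"
proof -
  have r: "Phi \<otimes>\<^sub>3 Phi_inv = \<one>\<^bsub>T 3\<^esub>"
    using reassoc_unit by simp
  have c: "Phi \<otimes>\<^sub>3 (Phi_inv \<otimes>\<^sub>3 x) = x" if "x \<in> carrier (T 3)" for x
    using that r by (simp flip: T3.m_assoc)
  show "comult_at Q 2 0 (comult Q a) \<otimes>\<^sub>3 Phi
      = Phi \<otimes>\<^sub>3 comult_at Q 2 (Suc 0) (comult Q a)"
    using quasi_coassoc[of a] by (simp add: T3.m_assoc c)
  show "comult_at Q 2 (Suc 0) (comult Q a) \<otimes>\<^sub>3 Phi_inv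
      = Phi_inv \<otimes>\<^sub>3 comult_at Q 2 0 (comult Q a)"
    using quasi_coassoc[of a] by (simp add: T3.m_assoc r)
qed

text \<open>
  Quasi-coassociativity in the first three factors, applied to the first component of \<open>X\<close>; the
  second component sits in the fourth factor and commutes with \<open>\<Phi> \<otimes> 1\<close>.
\<close>

lemma comult_twice_reassoc:
  assumes "X \<in> carrier (T 2)"
  shows "comult_at Q 3 0 (comult_at Q 2 0 X) \<otimes>\<^sub>4 e123 Phi
      = e123 Phi \<otimes>\<^sub>4 comult_at Q 3 (Suc 0) (comult_at Q 2 0 X)"
    and "e123 Phi_inv \<otimes>\<^sub>4 comult_at Q 3 0 (comult_at Q 2 0 X)
      = comult_at Q 3 (Suc 0) (comult_at Q 2 0 X) \<otimes>\<^sub>4 e123 Phi_inv"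
proof -
  have r: "e123 Phi_inv \<otimes>\<^sub>4 e123 Phi = \<one>\<^bsub>T 4\<^esub>"
    "e123 Phi \<otimes>\<^sub>4 e123 Phi_inv = \<one>\<^bsub>T 4\<^esub>"
    using reassoc_unit by (simp_all flip: hom_mult)
  show *: "comult_at Q 3 0 (comult_at Q 2 0 X) \<otimes>\<^sub>4 e123 Phi
      = e123 Phi \<otimes>\<^sub>4 comult_at Q 3 (Suc 0) (comult_at Q 2 0 X)"
    using assms
  proof (induct rule: tensor_induct2)
    case (pure a b)
    have "e123 (comult_at Q 2 0 (comult Q a)) \<otimes>\<^sub>4 (e123 Phi \<otimes>\<^sub>4 pure [1, 1, 1, b])
      = e123 (comult_at Q 2 0 (comult Q a) \<otimes>\<^sub>3 Phi) \<otimes>\<^sub>4 pure [1, 1, 1, b]"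
      by (simp add: hom_mult T4.m_assoc)
    also have "\<dots> = e123 Phi \<otimes>\<^sub>4 (e123 (comult_at Q 2 (Suc 0) (comult Q a)) \<otimes>\<^sub>4 pure [1, 1, 1, b])"
      by (simp add: comult_reassoc hom_mult T4.m_assoc)
    finally show ?case
      by (simp add: comult_at_pure_legs(1) hom_mult comult_at_legs comult_at_last T4.m_assoc
          leg_commute3)
  qed (simp add: T_distr)
  let ?L = "comult_at Q 3 0 (comult_at Q 2 0 X)" and ?R
      = "comult_at Q 3 (Suc 0) (comult_at Q 2 0 X)"
    and ?I = "e123 Phi_inv"
  have "?I \<otimes>\<^sub>4 ?L = ?I \<otimes>\<^sub>4 (?L \<otimes>\<^sub>4 e123 Phi) \<otimes>\<^sub>4 ?I"
    using assms r by (simp add: T4.m_assoc)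
  also have "\<dots> = (?I \<otimes>\<^sub>4 e123 Phi) \<otimes>\<^sub>4 (?R \<otimes>\<^sub>4 ?I)"
    unfolding * using assms by (simp add: T4.m_assoc)
  also have "\<dots> = ?R \<otimes>\<^sub>4 ?I"
    using assms r by simp
  finally show "?I \<otimes>\<^sub>4 ?L = ?R \<otimes>\<^sub>4 ?I" .
qed

lemma multilinear_form_counit:
  "multilinear_form 2 (\<lambda>w. scal Q (counit Q (w ! 0)) (w ! 1))"
  "multilinear_form 2 (\<lambda>w. scal Q (counit Q (w ! 1)) (w ! 0))"
  by (rule multilinear_form2I;
      simp add: counit_add counit_scal scale_left_distrib scale_right_distrib mult.commute)+

abbreviation eps_left :: "('h, 'k) tensor \<Rightarrow> 'h" where
  "eps_left \<equiv> tensor_eval (scal Q) (\<lambda>w. scal Q (counit Q (w ! 0)) (w ! (Suc 0)))"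
abbreviation eps_right :: "('h, 'k) tensor \<Rightarrow> 'h" where
  "eps_right \<equiv> tensor_eval (scal Q) (\<lambda>w. scal Q (counit Q (w ! (Suc 0))) (w ! 0))"

lemmas eps_simps [simp] = tensor_eval_add[OF multilinear_form_counit(1), simplified]
  tensor_eval_add[OF multilinear_form_counit(2), simplified]
  tensor_eval_pure[OF multilinear_form_counit(1), of "[_, _]", simplified]
  tensor_eval_pure[OF multilinear_form_counit(2), of "[_, _]", simplified]

lemma counit_middle_e12: "X \<in> carrier (T 2) \<Longrightarrow> counit_middle (e12 X) = pure [eps_right X, 1]"
  by (induct X rule: tensor_induct2) (simp_all add: pure_add_low)

lemma counit_middle_comult: "X \<in> carrier (T 2) \<Longrightarrow> counit_middle (comult_at Q 2 0 X) = X"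
  by (induct X rule: tensor_induct2)
    (simp_all add: comult_at_pure_legs hom_mult counit_middle_e12 counit_one
        counit_right[simplified])

lemma eps_mult:
  assumes "X \<in> carrier (T 2)" "Y \<in> carrier (T 2)"
  shows "eps_left (X \<otimes>\<^sub>2 Y) = eps_left X * eps_left Y"
    and "eps_right (X \<otimes>\<^sub>2 Y) = eps_right X * eps_right Y"
proof -
  have "eps_left (X \<otimes>\<^sub>2 Y) = eps_left X * eps_left Y
      \<and> eps_right (X \<otimes>\<^sub>2 Y) = eps_right X * eps_right Y"
    using assms(1)
  proof (induct rule: tensor_induct2)
    case (pure a b)
    show ?case
      using assms(2)
      by (induct rule: tensor_induct2)
        (simp_all add: counit_mult sc_mult_left sc_mult_right T_distr distrib_left mult.commute)
  next
    case (add X Z)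
    then show ?case
      using assms(2) by (simp add: T_distr distrib_right)
  qed
  then show "eps_left (X \<otimes>\<^sub>2 Y) = eps_left X * eps_left Y"
    "eps_right (X \<otimes>\<^sub>2 Y) = eps_right X * eps_right Y" by simp_all
qed

end

section \<open>Contractions with the antipode\<close>

context quasi_hopf_algebra
begin

abbreviation S :: "'h \<Rightarrow> 'h" where "S \<equiv> antipode Q"
abbreviation alpha :: 'h ("\<alpha>") where "\<alpha> \<equiv> antipode_alpha Q"
abbreviation beta :: 'h ("\<beta>") where "\<beta> \<equiv> antipode_beta Q"

text \<open>
  With these contractions \<open>\<alpha>\<^sub>G\<close> is \<open>left_contract \<alpha> G\<^sup>-\<^sup>1\<close> and \<open>\<beta>\<^sub>G\<close> is \<open>right_contract \<beta> G\<close>,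
  and the antipode axioms state that contracting \<open>\<Delta>(h)\<close> gives \<open>\<epsilon>(h)\<close> times \<open>\<alpha>\<close> or \<open>\<beta>\<close>.
\<close>

definition left_contract :: "'h \<Rightarrow> ('h, 'k) tensor \<Rightarrow> 'h" where
  "left_contract a = tensor_eval (scal Q) (\<lambda>w. S (w ! 0) * a * (w ! 1))"

definition right_contract :: "'h \<Rightarrow> ('h, 'k) tensor \<Rightarrow> 'h" where
  "right_contract b = tensor_eval (scal Q) (\<lambda>w. (w ! 0) * b * S (w ! 1))"

lemma multilinear_form_contract:
  "multilinear_form 2 (\<lambda>w. S (w ! 0) * a * (w ! 1))"
  "multilinear_form 2 (\<lambda>w. (w ! 0) * b * S (w ! 1))"
  by (rule multilinear_form2I;
      simp add: antipode_add antipode_scal distrib_left distrib_right sc_mult_left sc_mult_right)+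

lemma contract_simps [simp]:
  "left_contract a (pure [x, y]) = S x * a * y"
  "right_contract b (pure [x, y]) = x * b * S y"
  "X \<in> carrier (T 2) \<Longrightarrow> Y \<in> carrier (T 2) \<Longrightarrow>
    left_contract a (X \<oplus>\<^sub>2 Y) = left_contract a X + left_contract a Y"
  "X \<in> carrier (T 2) \<Longrightarrow> Y \<in> carrier (T 2) \<Longrightarrow>
    right_contract b (X \<oplus>\<^sub>2 Y) = right_contract b X + right_contract b Y"
  "left_contract \<alpha> (comult Q h) = scal Q (counit Q h) \<alpha>"
  "right_contract \<beta> (comult Q h) = scal Q (counit Q h) \<beta>"
  by (simp_all add: left_contract_def right_contract_def antipode_left antipode_right
      tensor_eval_pure[OF multilinear_form_contract(1)]
          tensor_eval_pure[OF multilinear_form_contract(2)]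
      tensor_eval_add[OF multilinear_form_contract(1)]
          tensor_eval_add[OF multilinear_form_contract(2)]
      del: One_nat_def)

text \<open>
  The anti-homomorphism \<open>X \<mapsto> (S \<otimes> S)X\<^sup>T\<close>.
\<close>

definition antipode_flip :: "('h, 'k) tensor \<Rightarrow> ('h, 'k) tensor" where
  "antipode_flip X = antipode_tensor Q (tensor_flip (scal Q) X)"

lemma multilinear_antipode: "multilinear 2 2 (\<lambda>w. pure [S (w ! 0), S (w ! 1)])"
  by (rule multilinear2I) (simp_all add: antipode_add antipode_scal multilinear_simps)

lemma antipode_flip_simps [simp]:
  "antipode_flip (pure [a, b]) = pure [S b, S a]"
  "X \<in> carrier (T 2) \<Longrightarrow> antipode_flip X \<in> carrier (T 2)"
  "X \<in> carrier (T 2) \<Longrightarrow> Y \<in> carrier (T 2) \<Longrightarrow> antipode_flip (X \<oplus>\<^sub>2 Y)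
      = antipode_flip X \<oplus>\<^sub>2 antipode_flip Y"
  "X \<in> carrier (T 2) \<Longrightarrow> antipode_flip (tsc 2 c X) = tsc 2 c (antipode_flip X)"
proof -
  note ml = multilinear_antipode multilinear_flip
  note [simp] = ml[THEN tensor_lift_closed] ml[THEN tensor_lift_add] ml[THEN tensor_lift_scale]
    ml[THEN tensor_lift_pure]
  note [simp del] = One_nat_def
  show "antipode_flip (pure [a, b]) = pure [S b, S a]"
    by (simp add: antipode_flip_def antipode_tensor_def)
  show "X \<in> carrier (T 2) \<Longrightarrow> antipode_flip X \<in> carrier (T 2)"
    "X \<in> carrier (T 2) \<Longrightarrow> Y \<in> carrier (T 2) \<Longrightarrow> antipode_flip (X \<oplus>\<^sub>2 Y)
        = antipode_flip X \<oplus>\<^sub>2 antipode_flip Y"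
    "X \<in> carrier (T 2) \<Longrightarrow> antipode_flip (tsc 2 c X) = tsc 2 c (antipode_flip X)"
    by (simp_all add: antipode_flip_def antipode_tensor_def tensor_flip_def)
qed

lemma antipode_flip_mult:
  assumes "X \<in> carrier (T 2)" "Y \<in> carrier (T 2)"
  shows "antipode_flip (X \<otimes>\<^sub>2 Y) = antipode_flip Y \<otimes>\<^sub>2 antipode_flip X"
  using assms(1)
proof (induct rule: tensor_induct2)
  case (pure a b)
  show ?case
    using assms(2) by (induct rule: tensor_induct2) (simp_all add: antipode_mult T_distr)
qed (use assms(2) in \<open>simp add: T_distr\<close>)

lemma antipode_flip_one [simp]: "antipode_flip \<one>\<^bsub>T 2\<^esub> = \<one>\<^bsub>T 2\<^esub>"
  by (simp add: one_low antipode_one)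

lemmas linear_simps = multilinear_simps T_distr T_scale_mult[of 2, simplified]
  T_scale_mult[of 3, simplified] T_scale_mult[of 4, simplified] comult_add comult_scal
  antipode_add antipode_scal

text \<open>
  The linear maps whose values at the four-fold tensors in the definition of the Drinfeld twist
  are \<open>\<gamma>\<close> with and without a bar. The two occurrences of \<open>\<alpha>\<close> or \<open>\<beta>\<close> are separate parameters,
  because they are exchanged for their twisted versions one at a time.
\<close>

definition gamma_bar_map :: "'h \<Rightarrow> 'h \<Rightarrow> ('h, 'k) tensor \<Rightarrow> ('h, 'k) tensor" where
  "gamma_bar_map b b' = tensor_lift (scal Q) 2 (\<lambda>w. pure [(w ! 0) * b * S (w ! 3),
      (w ! 1) * b' * S (w ! 2)])"

definition gamma_map :: "'h \<Rightarrow> 'h \<Rightarrow> ('h, 'k) tensor \<Rightarrow> ('h, 'k) tensor" where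
  "gamma_map a a' = tensor_lift (scal Q) 2 (\<lambda>w. pure [S (w ! 1) * a * (w ! 2), S (w ! 0) * a' *
      (w ! 3)])"

lemma multilinear_gamma_bar_map:
  "multilinear 4 2 (\<lambda>w. pure [(w ! 0) * b * S (w ! 3), (w ! 1) * b' * S (w ! 2)])"
  by (rule multilinear4I) (simp_all add: linear_simps)

lemma multilinear_gamma_map:
  "multilinear 4 2 (\<lambda>w. pure [S (w ! 1) * a * (w ! 2), S (w ! 0) * a' * (w ! 3)])"
  by (rule multilinear4I) (simp_all add: linear_simps)

lemma gamma_map_simps [simp]:
  "gamma_bar_map b b' (pure [p, q, r, s]) = pure [p * b * S s, q * b' * S r]"
  "gamma_map a a' (pure [p, q, r, s]) = pure [S q * a * r, S p * a' * s]"
  "W \<in> carrier (T 4) \<Longrightarrow> gamma_bar_map b b' W \<in> carrier (T 2)"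
  "W \<in> carrier (T 4) \<Longrightarrow> gamma_map a a' W \<in> carrier (T 2)"
  "W \<in> carrier (T 4) \<Longrightarrow> V \<in> carrier (T 4) \<Longrightarrow> gamma_bar_map b b' (W \<oplus>\<^sub>4 V)
      = gamma_bar_map b b' W \<oplus>\<^sub>2 gamma_bar_map b b' V"
  "W \<in> carrier (T 4) \<Longrightarrow> V \<in> carrier (T 4) \<Longrightarrow> gamma_map a a' (W \<oplus>\<^sub>4 V)
      = gamma_map a a' W \<oplus>\<^sub>2 gamma_map a a' V"
  "W \<in> carrier (T 4) \<Longrightarrow> gamma_bar_map b b' (tsc 4 c W) = tsc 2 c (gamma_bar_map b b' W)"
  "W \<in> carrier (T 4) \<Longrightarrow> gamma_map a a' (tsc 4 c W) = tsc 2 c (gamma_map a a' W)"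
  using tensor_lift_pure[OF multilinear_gamma_bar_map] tensor_lift_pure[OF multilinear_gamma_map]
    tensor_lift_closed[OF multilinear_gamma_bar_map] tensor_lift_closed[OF multilinear_gamma_map]
    tensor_lift_add[OF multilinear_gamma_bar_map] tensor_lift_add[OF multilinear_gamma_map]
    tensor_lift_scale[OF multilinear_gamma_bar_map] tensor_lift_scale[OF multilinear_gamma_map]
  by (simp_all add: gamma_bar_map_def gamma_map_def)

text \<open>
  \<open>S\<close> reverses products, so \<open>a x \<cdot> b \<cdot> S(d y) = a (x b S(y)) S(d)\<close>: a tensor multiplied into two
  factors joined by \<open>b\<close> can be absorbed into \<open>b\<close>, and dually on the left for \<open>\<alpha>\<close>.
\<close>

lemma gamma_map_absorb:
  assumes W: "W \<in> carrier (T 4)" and X: "X \<in> carrier (T 2)"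
  shows "gamma_bar_map b b' (W \<otimes>\<^sub>4 leg14 X) = gamma_bar_map (right_contract b X) b' W"
    and "gamma_bar_map b b' (W \<otimes>\<^sub>4 e123 (e23 X)) = gamma_bar_map b (right_contract b' X) W"
    and "gamma_map a a' (leg14 X \<otimes>\<^sub>4 W) = gamma_map a (left_contract a' X) W"
    and "gamma_map a a' (e123 (e23 X) \<otimes>\<^sub>4 W) = gamma_map (left_contract a X) a' W"
proof -
  have "gamma_bar_map b b' (W \<otimes>\<^sub>4 leg14 X) = gamma_bar_map (right_contract b X) b' W
    \<and> gamma_bar_map b b' (W \<otimes>\<^sub>4 e123 (e23 X)) = gamma_bar_map b (right_contract b' X) W
    \<and> gamma_map a a' (leg14 X \<otimes>\<^sub>4 W) = gamma_map a (left_contract a' X) W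
    \<and> gamma_map a a' (e123 (e23 X) \<otimes>\<^sub>4 W) = gamma_map (left_contract a X) a' W"
    using W
  proof (induct rule: tensor_induct4)
    case (pure p q r s)
    show ?case
      using X by (induct rule: tensor_induct2) (simp_all add: linear_simps antipode_mult mult.assoc)
  qed (use X in \<open>simp add: T_distr\<close>)
  then show "gamma_bar_map b b' (W \<otimes>\<^sub>4 leg14 X) = gamma_bar_map (right_contract b X) b' W"
    "gamma_bar_map b b' (W \<otimes>\<^sub>4 e123 (e23 X)) = gamma_bar_map b (right_contract b' X) W"
    "gamma_map a a' (leg14 X \<otimes>\<^sub>4 W) = gamma_map a (left_contract a' X) W"
    "gamma_map a a' (e123 (e23 X) \<otimes>\<^sub>4 W) = gamma_map (left_contract a X) a' W"
    by simp_all
qed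

text \<open>
  Factors on the side not facing \<open>\<alpha>\<close> or \<open>\<beta>\<close> leave the contraction: two of them unchanged, the
  other two through \<open>S\<close>, in reversed order and flipped.
\<close>

lemma gamma_map_outer:
  assumes W: "W \<in> carrier (T 4)" and X: "X \<in> carrier (T 2)" and Y: "Y \<in> carrier (T 2)"
  shows "gamma_bar_map b b' (e123 (e12 X) \<otimes>\<^sub>4 (e234 (e23 Y) \<otimes>\<^sub>4 W))
      = X \<otimes>\<^sub>2 gamma_bar_map b b' W \<otimes>\<^sub>2 antipode_flip Y"
    and "gamma_map a a' (W \<otimes>\<^sub>4 (e123 (e12 X) \<otimes>\<^sub>4 e234 (e23 Y)))
        = antipode_flip X \<otimes>\<^sub>2 gamma_map a a' W \<otimes>\<^sub>2 Y"
proof -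
  have "gamma_bar_map b b' (e123 (e12 X) \<otimes>\<^sub>4 (e234 (e23 Y) \<otimes>\<^sub>4 W))
      = X \<otimes>\<^sub>2 gamma_bar_map b b' W \<otimes>\<^sub>2 antipode_flip Y
    \<and> gamma_map a a' (W \<otimes>\<^sub>4 (e123 (e12 X) \<otimes>\<^sub>4 e234 (e23 Y)))
        = antipode_flip X \<otimes>\<^sub>2 gamma_map a a' W \<otimes>\<^sub>2 Y"
    using W
  proof (induct rule: tensor_induct4)
    case (pure p q r s)
    show ?case
      using X
    proof (induct rule: tensor_induct2)
      case (pure x y)
      show ?case
        using Y by (induct rule: tensor_induct2) (simp_all add: T_distr antipode_mult mult.assoc)
    qed (use Y in \<open>simp add: T_distr\<close>)
  qed (use X Y in \<open>simp add: T_distr\<close>)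
  then show "gamma_bar_map b b' (e123 (e12 X) \<otimes>\<^sub>4 (e234 (e23 Y) \<otimes>\<^sub>4 W))
      = X \<otimes>\<^sub>2 gamma_bar_map b b' W \<otimes>\<^sub>2 antipode_flip Y"
    "gamma_map a a' (W \<otimes>\<^sub>4 (e123 (e12 X) \<otimes>\<^sub>4 e234 (e23 Y)))
        = antipode_flip X \<otimes>\<^sub>2 gamma_map a a' W \<otimes>\<^sub>2 Y"
    by simp_all
qed

text \<open>
  A coproduct in the two inner factors is absorbed and then evaluated by the antipode axiom; its
  counit may be put next to the outer factors.
\<close>

lemma gamma_map_comult_middle:
  assumes W: "W \<in> carrier (T 4)" and P: "P \<in> carrier (T 3)"
  shows "gamma_bar_map b \<beta> (W \<otimes>\<^sub>4 comult_at Q 3 (Suc 0) P)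
      = gamma_bar_map b \<beta> (W \<otimes>\<^sub>4 leg14 (counit_middle P))"
    and "gamma_map \<alpha> a (comult_at Q 3 (Suc 0) P \<otimes>\<^sub>4 W)
      = gamma_map \<alpha> a (leg14 (counit_middle P) \<otimes>\<^sub>4 W)"
proof -
  have "gamma_bar_map b \<beta> (W \<otimes>\<^sub>4 comult_at Q 3 (Suc 0) P)
      = gamma_bar_map b \<beta> (W \<otimes>\<^sub>4 leg14 (counit_middle P))
    \<and> gamma_map \<alpha> a (comult_at Q 3 (Suc 0) P \<otimes>\<^sub>4 W)
      = gamma_map \<alpha> a (leg14 (counit_middle P) \<otimes>\<^sub>4 W)"
    using P
  proof (induct rule: tensor_induct3)
    case (pure x y z)
    show ?case
      using W
    proof (induct rule: tensor_induct4)
      case (pure p q r s)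
      have "gamma_bar_map b \<beta> (pure [p, q, r, s] \<otimes>\<^sub>4 (pure [x, 1, 1, z]
          \<otimes>\<^sub>4 e123 (e23 (comult Q y))))
          = gamma_bar_map b (scal Q (counit Q y) \<beta>) (pure [p, q, r, s] \<otimes>\<^sub>4 pure [x, 1, 1, z])"
        by (simp add: gamma_map_absorb flip: T4.m_assoc)
      moreover have "gamma_map \<alpha> a ((e123 (e23 (comult Q y)) \<otimes>\<^sub>4 pure [x, 1, 1, z])
          \<otimes>\<^sub>4 pure [p, q, r, s])
          = gamma_map (scal Q (counit Q y) \<alpha>) a (pure [x, 1, 1, z] \<otimes>\<^sub>4 pure [p, q, r, s])"
        by (simp add: gamma_map_absorb T4.m_assoc)
      ultimately show ?case
        unfolding counit_middle_pure leg14_pure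
        by (simp add: comult_at_pure_legs leg_commute linear_simps)
    qed (simp add: T_distr)
  qed (use W in \<open>simp add: T_distr\<close>)
  then show "gamma_bar_map b \<beta> (W \<otimes>\<^sub>4 comult_at Q 3 (Suc 0) P)
      = gamma_bar_map b \<beta> (W \<otimes>\<^sub>4 leg14 (counit_middle P))"
    "gamma_map \<alpha> a (comult_at Q 3 (Suc 0) P \<otimes>\<^sub>4 W)
      = gamma_map \<alpha> a (leg14 (counit_middle P) \<otimes>\<^sub>4 W)"
    by simp_all
qed

section \<open>The element gamma and the Drinfeld twist as values of linear maps\<close>

text \<open>
  For \<open>X = \<Sum> x \<otimes> y\<close> these are \<open>\<Sum> \<Delta>(x) k (S \<otimes> S)\<Delta>\<^sup>T(y)\<close> and \<open>\<Sum> (S \<otimes> S)\<Delta>\<^sup>T(x) k \<Delta>(y)\<close>.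
\<close>

definition sandwich_comult_antipode :: "('h, 'k) tensor \<Rightarrow> ('h, 'k) tensor \<Rightarrow> ('h, 'k) tensor" where
  "sandwich_comult_antipode k = tensor_lift (scal Q) 2 (\<lambda>w. comult Q (w ! 0) \<otimes>\<^sub>2 k
      \<otimes>\<^sub>2 antipode_flip (comult Q (w ! 1)))"

definition sandwich_antipode_comult :: "('h, 'k) tensor \<Rightarrow> ('h, 'k) tensor \<Rightarrow> ('h, 'k) tensor" where
  "sandwich_antipode_comult k = tensor_lift (scal Q) 2 (\<lambda>w. antipode_flip (comult Q (w ! 0)) \<otimes>\<^sub>2 k
      \<otimes>\<^sub>2 comult Q (w ! 1))"

text \<open>
  The inverse Drinfeld twist and the Drinfeld twist are the values of the following maps at \<open>\<Phi>\<close>.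
  The elements \<open>\<alpha>\<close>, \<open>\<beta>\<close> and \<open>\<gamma>\<close> are parameters, so that twisting changes parameters and argument
  only.
\<close>

definition drinfeld_inv_map :: "'h \<Rightarrow> ('h, 'k) tensor \<Rightarrow> ('h, 'k) tensor \<Rightarrow> ('h, 'k) tensor" where
  "drinfeld_inv_map a k = tensor_lift (scal Q) 2
     (\<lambda>w. comult Q (S (w ! 0) * a * (w ! 1)) \<otimes>\<^sub>2 k \<otimes>\<^sub>2 antipode_flip (comult Q (w ! 2)))"

definition drinfeld_map :: "('h, 'k) tensor \<Rightarrow> 'h \<Rightarrow> ('h, 'k) tensor \<Rightarrow> ('h, 'k) tensor" where
  "drinfeld_map k b = tensor_lift (scal Q) 2
     (\<lambda>w. antipode_flip (comult Q (w ! 0)) \<otimes>\<^sub>2 k \<otimes>\<^sub>2 comult Q ((w ! 1) * b * S (w ! 2)))"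

lemma multilinear_drinfeld_maps:
  assumes "k \<in> carrier (T 2)"
  shows "multilinear 2 2 (\<lambda>w. comult Q (w ! 0) \<otimes>\<^sub>2 k \<otimes>\<^sub>2 antipode_flip (comult Q (w ! 1)))"
    and "multilinear 2 2 (\<lambda>w. antipode_flip (comult Q (w ! 0)) \<otimes>\<^sub>2 k \<otimes>\<^sub>2 comult Q (w ! 1))"
    and "multilinear 3 2
     (\<lambda>w. comult Q (S (w ! 0) * a * (w ! 1)) \<otimes>\<^sub>2 k \<otimes>\<^sub>2 antipode_flip (comult Q (w ! 2)))"
    and "multilinear 3 2
     (\<lambda>w. antipode_flip (comult Q (w ! 0)) \<otimes>\<^sub>2 k \<otimes>\<^sub>2 comult Q ((w ! 1) * b * S (w ! 2)))"
  using assms by (auto intro!: multilinear2I multilinear3I simp: linear_simps)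

context
  fixes k
  assumes k [simp]: "k \<in> carrier (T 2)"
begin

lemma drinfeld_map_simps [simp]:
  "sandwich_comult_antipode k (pure [x, y]) = comult Q x \<otimes>\<^sub>2 k \<otimes>\<^sub>2 antipode_flip (comult Q y)"
  "sandwich_antipode_comult k (pure [x, y]) = antipode_flip (comult Q x) \<otimes>\<^sub>2 k \<otimes>\<^sub>2 comult Q y"
  "drinfeld_inv_map a k (pure [x, y, z])
    = comult Q (S x * a * y) \<otimes>\<^sub>2 k \<otimes>\<^sub>2 antipode_flip (comult Q z)"
  "drinfeld_map k b (pure [x, y, z])
    = antipode_flip (comult Q x) \<otimes>\<^sub>2 k \<otimes>\<^sub>2 comult Q (y * b * S z)"
  using multilinear_drinfeld_maps[OF k, THEN tensor_lift_pure]
  by (simp_all add: sandwich_comult_antipode_def sandwich_antipode_comult_def drinfeld_inv_map_def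
      drinfeld_map_def)

lemma drinfeld_map_closed [simp]:
  "X \<in> carrier (T 2) \<Longrightarrow> sandwich_comult_antipode k X \<in> carrier (T 2)"
  "X \<in> carrier (T 2) \<Longrightarrow> sandwich_antipode_comult k X \<in> carrier (T 2)"
  "W \<in> carrier (T 3) \<Longrightarrow> drinfeld_inv_map a k W \<in> carrier (T 2)"
  "W \<in> carrier (T 3) \<Longrightarrow> drinfeld_map k b W \<in> carrier (T 2)"
  unfolding sandwich_comult_antipode_def sandwich_antipode_comult_def drinfeld_inv_map_def
      drinfeld_map_def
  by (rule multilinear_drinfeld_maps[OF k, THEN tensor_lift_closed]; assumption)+

lemma drinfeld_map_scale [simp]:
  "W \<in> carrier (T 3) \<Longrightarrow> drinfeld_inv_map a k (tsc 3 c W) = tsc 2 c (drinfeld_inv_map a k W)"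
  "W \<in> carrier (T 3) \<Longrightarrow> drinfeld_map k b (tsc 3 c W) = tsc 2 c (drinfeld_map k b W)"
  unfolding drinfeld_inv_map_def drinfeld_map_def
  by (rule multilinear_drinfeld_maps[OF k, THEN tensor_lift_scale]; assumption)+

lemma drinfeld_map_add [simp]:
  "X \<in> carrier (T 2) \<Longrightarrow> Y \<in> carrier (T 2) \<Longrightarrow> sandwich_comult_antipode k (X \<oplus>\<^sub>2 Y)
      = sandwich_comult_antipode k X \<oplus>\<^sub>2 sandwich_comult_antipode k Y"
  "X \<in> carrier (T 2) \<Longrightarrow> Y \<in> carrier (T 2) \<Longrightarrow> sandwich_antipode_comult k (X \<oplus>\<^sub>2 Y)
      = sandwich_antipode_comult k X \<oplus>\<^sub>2 sandwich_antipode_comult k Y"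
  "W \<in> carrier (T 3) \<Longrightarrow> V \<in> carrier (T 3) \<Longrightarrow>
    drinfeld_inv_map a k (W \<oplus>\<^sub>3 V) = drinfeld_inv_map a k W \<oplus>\<^sub>2 drinfeld_inv_map a k V"
  "W \<in> carrier (T 3) \<Longrightarrow> V \<in> carrier (T 3) \<Longrightarrow>
    drinfeld_map k b (W \<oplus>\<^sub>3 V) = drinfeld_map k b W \<oplus>\<^sub>2 drinfeld_map k b V"
  unfolding sandwich_comult_antipode_def sandwich_antipode_comult_def drinfeld_inv_map_def
      drinfeld_map_def
  by (rule multilinear_drinfeld_maps[OF k, THEN tensor_lift_add]; assumption)+

end

text \<open>
  The parameters absorb factors of the argument; on the side of \<open>k\<close> the multiplicativity of \<open>\<Delta>\<close>
  and the anti-multiplicativity of \<open>S\<close> let \<open>k\<close> absorb them in the form of a sandwich.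
\<close>

lemma drinfeld_map_absorb:
  assumes k [simp]: "k \<in> carrier (T 2)" and W: "W \<in> carrier (T 3)" and X: "X \<in> carrier (T 2)"
  shows "drinfeld_inv_map a k (e12 X \<otimes>\<^sub>3 W) = drinfeld_inv_map (left_contract a X) k W"
    and "drinfeld_inv_map a k (W \<otimes>\<^sub>3 e23 X) = drinfeld_inv_map a (sandwich_comult_antipode k X) W"
    and "drinfeld_map k b (e12 X \<otimes>\<^sub>3 W) = drinfeld_map (sandwich_antipode_comult k X) b W"
    and "drinfeld_map k b (W \<otimes>\<^sub>3 e23 X) = drinfeld_map k (right_contract b X) W"
proof -
  have "drinfeld_inv_map a k (e12 X \<otimes>\<^sub>3 W) = drinfeld_inv_map (left_contract a X) k W
    \<and> drinfeld_inv_map a k (W \<otimes>\<^sub>3 e23 X) = drinfeld_inv_map a (sandwich_comult_antipode k X) W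
    \<and> drinfeld_map k b (e12 X \<otimes>\<^sub>3 W) = drinfeld_map (sandwich_antipode_comult k X) b W
    \<and> drinfeld_map k b (W \<otimes>\<^sub>3 e23 X) = drinfeld_map k (right_contract b X) W"
    using W
  proof (induct rule: tensor_induct3)
    case (pure p q r)
    show ?case
      using X
    proof (induct rule: tensor_induct2)
      case (pure x y)
      show ?case
        by (simp add: antipode_mult comult_mult antipode_flip_mult mult.assoc T2.m_assoc)
    next
      case (add Y Z)
      then show ?case
        by (simp add: linear_simps)
    qed
  qed (use X in \<open>simp add: T_distr\<close>)
  then show "drinfeld_inv_map a k (e12 X \<otimes>\<^sub>3 W) = drinfeld_inv_map (left_contract a X) k W"
    "drinfeld_inv_map a k (W \<otimes>\<^sub>3 e23 X) = drinfeld_inv_map a (sandwich_comult_antipode k X) W"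
    "drinfeld_map k b (e12 X \<otimes>\<^sub>3 W) = drinfeld_map (sandwich_antipode_comult k X) b W"
    "drinfeld_map k b (W \<otimes>\<^sub>3 e23 X) = drinfeld_map k (right_contract b X) W"
    by simp_all
qed

text \<open>
  \<open>(\<Delta> \<otimes> \<Delta>)(x \<otimes> y)\<close> is the product of \<open>\<Delta>(x)\<close> in the first two and \<open>\<Delta>(y)\<close> in the last two factors,
  so \<open>gamma_map_outer\<close> applies.
\<close>

lemma gamma_map_comult_comult:
  assumes W [simp]: "W \<in> carrier (T 4)" and X: "X \<in> carrier (T 2)"
  shows "gamma_bar_map b b' (comult_at Q 3 0 (comult_at Q 2 (Suc 0) X) \<otimes>\<^sub>4 W)
      = sandwich_comult_antipode (gamma_bar_map b b' W) X"
    and "gamma_map a a' (W \<otimes>\<^sub>4 comult_at Q 3 0 (comult_at Q 2 (Suc 0) X))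
        = sandwich_antipode_comult (gamma_map a a' W) X"
proof -
  have "gamma_bar_map b b' (comult_at Q 3 0 (comult_at Q 2 (Suc 0) X) \<otimes>\<^sub>4 W)
      = sandwich_comult_antipode (gamma_bar_map b b' W) X
    \<and> gamma_map a a' (W \<otimes>\<^sub>4 comult_at Q 3 0 (comult_at Q 2 (Suc 0) X))
        = sandwich_antipode_comult (gamma_map a a' W) X"
    using X
  proof (induct rule: tensor_induct2)
    case (pure x y)
    have "comult_at Q 3 0 (pure [x, 1, 1]) = e123 (e12 (comult Q x))"
      using T4.r_one[of "e123 (e12 (comult Q x))"] by (simp add: comult_at_pure_legs one_low)
    then have "comult_at Q 3 0 (comult_at Q 2 (Suc 0) (pure [x, y]))
        = e123 (e12 (comult Q x)) \<otimes>\<^sub>4 e234 (e23 (comult Q y))"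
      by (simp add: comult_at_pure_legs(2) hom_mult comult_at_legs)
    then show ?case
      by (simp add: gamma_map_outer T4.m_assoc)
  qed (simp add: T_distr)
  then show "gamma_bar_map b b' (comult_at Q 3 0 (comult_at Q 2 (Suc 0) X) \<otimes>\<^sub>4 W)
      = sandwich_comult_antipode (gamma_bar_map b b' W) X"
    "gamma_map a a' (W \<otimes>\<^sub>4 comult_at Q 3 0 (comult_at Q 2 (Suc 0) X))
        = sandwich_antipode_comult (gamma_map a a' W) X"
    by simp_all
qed

lemma gamma_as_map:
  "drinfeld_gamma_bar Q = gamma_bar_map \<beta> \<beta>
     (comult_at Q 3 0 Phi_inv \<otimes>\<^sub>4 e123 Phi)"
  "drinfeld_gamma Q = gamma_map \<alpha> \<alpha>
     (e123 Phi_inv \<otimes>\<^sub>4 comult_at Q 3 0 Phi)"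
  by (simp_all add: drinfeld_gamma_bar_def drinfeld_gamma_def gamma_bar_map_def gamma_map_def)

lemma gamma_closed [simp]:
  "drinfeld_gamma_bar Q \<in> carrier (T 2)" "drinfeld_gamma Q \<in> carrier (T 2)"
  by (simp_all add: gamma_as_map)

text \<open>
  Two applications of quasi-coassociativity carry \<open>(\<Delta> \<otimes> \<Delta>)\<Delta>(x)\<close> from one end of the four-fold
  tensor to the other, where it has become \<open>(1 \<otimes> \<Delta> \<otimes> 1)(\<Delta> \<otimes> 1)\<Delta>(x)\<close>. There the antipode axiom
  for the inner pair of factors reduces it to \<open>\<Delta>(x)\<close> in the outer pair, and the one for the
  outer pair reduces this to \<open>\<epsilon>(x)\<close>.
\<close>

lemma gamma_invariant:
  "sandwich_comult_antipode (drinfeld_gamma_bar Q) (comult Q x)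
      = tsc 2 (counit Q x) (drinfeld_gamma_bar Q)"
  "sandwich_antipode_comult (drinfeld_gamma Q) (comult Q x) = tsc 2 (counit Q x) (drinfeld_gamma Q)"
proof -
  let ?D = "comult_at Q 2 0 (comult Q x)"
  let ?V = "comult_at Q 3 0 Phi_inv \<otimes>\<^sub>4 e123 Phi"
  let ?U = "e123 Phi_inv \<otimes>\<^sub>4 comult_at Q 3 0 Phi"
  have scale: "gamma_bar_map (scal Q e b) b' W
      = tsc 2 e (gamma_bar_map b b' W) \<and> gamma_map a (scal Q e a') W = tsc 2 e (gamma_map a a' W)"
    if "W \<in> carrier (T 4)" for e a a' b b' W
    using that by (induct rule: tensor_induct4) (simp_all add: linear_simps T_scale_add)
  have "comult_at Q 3 0 (comult_at Q 2 (Suc 0) (comult Q x)) \<otimes>\<^sub>4 ?V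
      = comult_at Q 3 0 (comult_at Q 2 (Suc 0) (comult Q x) \<otimes>\<^sub>3 Phi_inv) \<otimes>\<^sub>4 e123 Phi"
    by (simp add: hom_mult T4.m_assoc)
  also have "\<dots> = ?V \<otimes>\<^sub>4 comult_at Q 3 (Suc 0) ?D"
    by (simp add: comult_reassoc hom_mult T4.m_assoc comult_twice_reassoc)
  finally have "sandwich_comult_antipode (drinfeld_gamma_bar Q) (comult Q x)
      = gamma_bar_map \<beta> \<beta> (?V \<otimes>\<^sub>4 comult_at Q 3 (Suc 0) ?D)"
    by (simp add: gamma_as_map flip: gamma_map_comult_comult)
  also have "\<dots> = tsc 2 (counit Q x) (drinfeld_gamma_bar Q)"
    by (simp add: gamma_map_comult_middle counit_middle_comult gamma_map_absorb scale gamma_as_map)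
  finally show "sandwich_comult_antipode (drinfeld_gamma_bar Q) (comult Q x)
      = tsc 2 (counit Q x) (drinfeld_gamma_bar Q)" .
  have "?U \<otimes>\<^sub>4 comult_at Q 3 0 (comult_at Q 2 (Suc 0) (comult Q x))
      = e123 Phi_inv \<otimes>\<^sub>4 comult_at Q 3 0 (Phi \<otimes>\<^sub>3 comult_at Q 2 (Suc 0) (comult Q x))"
    by (simp add: hom_mult T4.m_assoc)
  also have "\<dots> = (e123 Phi_inv \<otimes>\<^sub>4 comult_at Q 3 0 ?D) \<otimes>\<^sub>4 comult_at Q 3 0 Phi"
    by (simp add: hom_mult T4.m_assoc flip: comult_reassoc)
  also have "\<dots> = comult_at Q 3 (Suc 0) ?D \<otimes>\<^sub>4 ?U"
    by (simp add: comult_twice_reassoc T4.m_assoc)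
  finally have "sandwich_antipode_comult (drinfeld_gamma Q) (comult Q x)
      = gamma_map \<alpha> \<alpha> (comult_at Q 3 (Suc 0) ?D \<otimes>\<^sub>4 ?U)"
    by (simp add: gamma_as_map flip: gamma_map_comult_comult)
  also have "\<dots> = tsc 2 (counit Q x) (drinfeld_gamma Q)"
    by (simp add: gamma_map_comult_middle counit_middle_comult gamma_map_absorb scale gamma_as_map)
  finally show "sandwich_antipode_comult (drinfeld_gamma Q) (comult Q x)
      = tsc 2 (counit Q x) (drinfeld_gamma Q)" .
qed

text \<open>
  The coproducts on the sides of \<open>\<alpha>\<close> and \<open>\<beta>\<close> are evaluated by the antipode axioms, those on the
  sides of \<open>\<gamma>\<close> by \<open>gamma_invariant\<close>. For a twist the remaining counit is \<open>1\<close>.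
\<close>

lemma drinfeld_map_comult:
  assumes W: "W \<in> carrier (T 3)" and X: "X \<in> carrier (T 2)"
  shows "k \<in> carrier (T 2) \<Longrightarrow> drinfeld_inv_map \<alpha> k (comult_at Q 2 0 X \<otimes>\<^sub>3 W)
      = drinfeld_inv_map \<alpha> k (pure [1, 1, eps_left X] \<otimes>\<^sub>3 W)"
    and "drinfeld_inv_map a (drinfeld_gamma_bar Q) (W \<otimes>\<^sub>3 comult_at Q 2 (Suc 0) X)
      = drinfeld_inv_map a (drinfeld_gamma_bar Q) (W \<otimes>\<^sub>3 pure [eps_right X, 1, 1])"
    and "drinfeld_map (drinfeld_gamma Q) b (comult_at Q 2 0 X \<otimes>\<^sub>3 W)
      = drinfeld_map (drinfeld_gamma Q) b (pure [1, 1, eps_left X] \<otimes>\<^sub>3 W)"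
    and "k \<in> carrier (T 2) \<Longrightarrow> drinfeld_map k \<beta> (W \<otimes>\<^sub>3 comult_at Q 2 (Suc 0) X)
      = drinfeld_map k \<beta> (W \<otimes>\<^sub>3 pure [eps_right X, 1, 1])"
proof -
  let ?g = "drinfeld_gamma Q" and ?h = "drinfeld_gamma_bar Q"
  have all: "drinfeld_inv_map \<alpha> k (comult_at Q 2 0 X \<otimes>\<^sub>3 W)
      = drinfeld_inv_map \<alpha> k (pure [1, 1, eps_left X] \<otimes>\<^sub>3 W)
    \<and> drinfeld_inv_map a ?h (W \<otimes>\<^sub>3 comult_at Q 2 (Suc 0) X)
      = drinfeld_inv_map a ?h (W \<otimes>\<^sub>3 pure [eps_right X, 1, 1])
    \<and> drinfeld_map ?g b (comult_at Q 2 0 X \<otimes>\<^sub>3 W)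
      = drinfeld_map ?g b (pure [1, 1, eps_left X] \<otimes>\<^sub>3 W)
    \<and> drinfeld_map k \<beta> (W \<otimes>\<^sub>3 comult_at Q 2 (Suc 0) X)
      = drinfeld_map k \<beta> (W \<otimes>\<^sub>3 pure [eps_right X, 1, 1])"
    if [simp]: "k \<in> carrier (T 2)" for k
    using X
  proof (induct rule: tensor_induct2)
    case (pure x y)
    show ?case
      using W
    proof (induct rule: tensor_induct3)
      case (pure p q r)
      have 1: "comult_at Q 2 0 (pure [x, y]) \<otimes>\<^sub>3 pure [p, q, r]
          = e12 (comult Q x) \<otimes>\<^sub>3 pure [p, q, y * r]"
        by (simp add: comult_at_pure_legs T3.m_assoc)
      have 2: "pure [p, q, r] \<otimes>\<^sub>3 comult_at Q 2 (Suc 0) (pure [x, y])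
          = pure [p * x, q, r] \<otimes>\<^sub>3 e23 (comult Q y)"
        by (simp add: comult_at_pure_legs flip: T3.m_assoc)
      show ?case
        by (simp add: 1 2 drinfeld_map_absorb gamma_invariant linear_simps)
    qed (simp add: T_distr comult_at_pure_legs)
  next
    case (add Y Z)
    then show ?case
      using W by (simp add: T_distr multilinear_simps)
  qed
  from all show "k \<in> carrier (T 2) \<Longrightarrow> drinfeld_inv_map \<alpha> k (comult_at Q 2 0 X \<otimes>\<^sub>3 W)
      = drinfeld_inv_map \<alpha> k (pure [1, 1, eps_left X] \<otimes>\<^sub>3 W)"
    "k \<in> carrier (T 2) \<Longrightarrow> drinfeld_map k \<beta> (W \<otimes>\<^sub>3 comult_at Q 2 (Suc 0) X)
      = drinfeld_map k \<beta> (W \<otimes>\<^sub>3 pure [eps_right X, 1, 1])"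
    by simp_all
  from all[OF T2.one_closed]
  show "drinfeld_inv_map a ?h (W \<otimes>\<^sub>3 comult_at Q 2 (Suc 0) X)
      = drinfeld_inv_map a ?h (W \<otimes>\<^sub>3 pure [eps_right X, 1, 1])"
    "drinfeld_map ?g b (comult_at Q 2 0 X \<otimes>\<^sub>3 W)
      = drinfeld_map ?g b (pure [1, 1, eps_left X] \<otimes>\<^sub>3 W)"
    by simp_all
qed

end

section \<open>Twisting the Drinfeld twist\<close>

locale quasi_hopf_algebra_with_twist = quasi_hopf_algebra Q
  for Q :: "('k::field, 'h::ring_1, 'm) quasi_hopf_scheme" +
  fixes G :: "('h, 'k) tensor"
  assumes twist: "is_twist Q G"
begin

abbreviation Gi :: "('h, 'k) tensor" where "Gi \<equiv> inv\<^bsub>T 2\<^esub> G"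

lemma G_closed [simp]: "G \<in> carrier (T 2)" "Gi \<in> carrier (T 2)"
  and G_inv [simp]: "G \<otimes>\<^sub>2 Gi = \<one>\<^bsub>T 2\<^esub>" "Gi \<otimes>\<^sub>2 G = \<one>\<^bsub>T 2\<^esub>"
  using twist by (auto simp: is_twist_def)

lemma eps_G [simp]: "eps_left G = 1" "eps_right G = 1" "eps_left Gi = 1" "eps_right Gi = 1"
proof -
  show 1: "eps_left G = 1" "eps_right G = 1"
    using twist by (simp_all add: is_twist_def)
  have one: "eps_left \<one>\<^bsub>T 2\<^esub> = 1" "eps_right \<one>\<^bsub>T 2\<^esub> = 1"
    by (simp_all add: one_low counit_one)
  from eps_mult[OF G_closed] one 1 show "eps_left Gi = 1" "eps_right Gi = 1"
    by simp_all
qed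

lemma twisted_simps [simp]:
  "scal (twisted Q G) = scal Q" "antipode (twisted Q G) = S"
  "comult (twisted Q G) = (\<lambda>a. G \<otimes>\<^sub>2 comult Q a \<otimes>\<^sub>2 Gi)"
  "antipode_alpha (twisted Q G) = left_contract \<alpha> Gi"
  "antipode_beta (twisted Q G) = right_contract \<beta> G"
  "reassoc (twisted Q G) = e12 G \<otimes>\<^sub>3 comult_at Q 2 0 G \<otimes>\<^sub>3 Phi
     \<otimes>\<^sub>3 comult_at Q 2 (Suc 0) Gi \<otimes>\<^sub>3 e23 Gi"
  by (simp_all add: twisted_def Let_def left_contract_def right_contract_def)

lemma hom_cancel:
  assumes h: "h \<in> ring_hom (T 2) (T m)" and m: "m > 0" and X: "X \<in> carrier (T m)"
  shows "h G \<otimes>\<^bsub>T m\<^esub> h Gi = \<one>\<^bsub>T m\<^esub>" "h Gi \<otimes>\<^bsub>T m\<^esub> h G = \<one>\<^bsub>T m\<^esub>"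
    "h G \<otimes>\<^bsub>T m\<^esub> (h Gi \<otimes>\<^bsub>T m\<^esub> X) = X" "h Gi \<otimes>\<^bsub>T m\<^esub> (h G \<otimes>\<^bsub>T m\<^esub> X) = X"
proof -
  interpret T: ring "T m" by (rule T_ring[OF m])
  note c = ring_hom_closed[OF h G_closed(1)] ring_hom_closed[OF h G_closed(2)]
  show 1: "h G \<otimes>\<^bsub>T m\<^esub> h Gi = \<one>\<^bsub>T m\<^esub>" "h Gi \<otimes>\<^bsub>T m\<^esub> h G = \<one>\<^bsub>T m\<^esub>"
    using ring_hom_mult[OF h G_closed] ring_hom_mult[OF h G_closed(2,1)] ring_hom_one[OF h]
        by simp_all
  show "h G \<otimes>\<^bsub>T m\<^esub> (h Gi \<otimes>\<^bsub>T m\<^esub> X) = X" "h Gi \<otimes>\<^bsub>T m\<^esub> (h G \<otimes>\<^bsub>T m\<^esub> X) = X"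
    using T.m_assoc[OF c(1) c(2) X] T.m_assoc[OF c(2) c(1) X] 1 X by simp_all
qed

lemmas twist_homs4 = leg14_ring_hom
  ring_hom_trans[OF leg_homs(1) leg_homs(3), unfolded comp_def]
  ring_hom_trans[OF leg_homs(2) leg_homs(3), unfolded comp_def]
  ring_hom_trans[OF leg_homs(2) leg_homs(4), unfolded comp_def]
  ring_hom_trans[OF leg_homs(7) leg_homs(3), unfolded comp_def]
  ring_hom_trans[OF leg_homs(8) leg_homs(3), unfolded comp_def]

lemmas twist_homs3 = leg_homs(1) leg_homs(2) leg_homs(7) leg_homs(8)

lemmas leg_cancel = twist_homs3[THEN hom_cancel(3), simplified]
    twist_homs3[THEN hom_cancel(4), simplified]
  twist_homs4[THEN hom_cancel(3), simplified] twist_homs4[THEN hom_cancel(4), simplified]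
  twist_homs3[THEN hom_cancel(1)[OF _ _ T3.one_closed], simplified]
  twist_homs3[THEN hom_cancel(2)[OF _ _ T3.one_closed], simplified]
  twist_homs4[THEN hom_cancel(1)[OF _ _ T4.one_closed], simplified]
  twist_homs4[THEN hom_cancel(2)[OF _ _ T4.one_closed], simplified]

lemma reassoc_cancel:
  "X \<in> carrier (T 3) \<Longrightarrow> Phi \<otimes>\<^sub>3 (Phi_inv \<otimes>\<^sub>3 X) = X"
  "X \<in> carrier (T 3) \<Longrightarrow> Phi_inv \<otimes>\<^sub>3 (Phi \<otimes>\<^sub>3 X) = X"
  using reassoc_unit by (simp_all flip: T3.m_assoc)

lemma twisted_reassoc_inv:
  "inv\<^bsub>T 3\<^esub> reassoc (twisted Q G) = e23 G \<otimes>\<^sub>3 comult_at Q 2 (Suc 0) G \<otimes>\<^sub>3 Phi_inv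
     \<otimes>\<^sub>3 comult_at Q 2 0 Gi \<otimes>\<^sub>3 e12 Gi"
  by (rule T3.inv_unique'[symmetric]) (simp_all add: T3.m_assoc leg_cancel reassoc_cancel)

lemma add_3_1: "3 + 1 = (4 :: nat)"
  by simp

text \<open>
  Conjugation by \<open>G\<close> in the first two factors commutes with the letters in the other two.
\<close>

lemma comult_at_twisted:
  assumes P: "P \<in> carrier (T 3)"
  shows "comult_at (twisted Q G) 3 0 P
    = e123 (e12 G) \<otimes>\<^sub>4 comult_at Q 3 0 P \<otimes>\<^sub>4 e123 (e12 Gi)"
proof -
  have "comult_at (twisted Q G) 3 0 P = tensor_lift (scal Q) 4
    (\<lambda>w. e123 (e12 G) \<otimes>\<^sub>4 tensor_lift (scal Q) 4 (\<lambda>u. pure (splice 0 w u)) (comult Q (w ! 0))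
      \<otimes>\<^sub>4 e123 (e12 Gi)) P"
    unfolding comult_at_def twisted_simps(1,3) add_3_1 using P
    by (intro tensor_lift_cong[where n = 3])
      (auto simp: length_3_iff lift_splice hom_mult T4.m_assoc leg_commute)
  also have "\<dots> = e123 (e12 G) \<otimes>\<^sub>4 comult_at Q 3 0 P \<otimes>\<^sub>4 e123 (e12 Gi)"
    using tensor_lift_sandwich[OF multilinear_comult_at[of 0 3], of "e123 (e12 G)" "e123
        (e12 Gi)" P] P
    by (simp add: comult_at_def)
  finally show ?thesis .
qed

lemma antipode_tensor_twisted [simp]: "antipode_tensor (twisted Q G) = antipode_tensor Q"
  by (simp add: antipode_tensor_def fun_eq_iff)

lemma comult_at_leg12_rev: "X \<in> carrier (T 2) \<Longrightarrow> e123 (comult_at Q 2 (Suc 0) X)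
    = comult_at Q 3 (Suc 0) (e12 X)"
  by (simp add: comult_at_legs)

text \<open>
  The outer factors \<open>G\<^sup>-\<^sup>1\<close> cancel the \<open>G\<close> in front of the twisted four-fold tensor, and the
  inner copy of \<open>\<beta>\<^sub>G\<close> cancels \<open>G\<^sup>-\<^sup>1\<close> at its end. Quasi-coassociativity gives the other factors
  \<open>G\<^sup>-\<^sup>1\<close> a coproduct in the inner positions; the antipode axiom leaves a single \<open>G\<^sup>-\<^sup>1\<close> in the
  outer positions, where the other copy of \<open>\<beta>\<^sub>G\<close> cancels it.
\<close>

lemma gamma_bar_twisted:
  "Gi \<otimes>\<^sub>2 drinfeld_gamma_bar (twisted Q G) \<otimes>\<^sub>2 antipode_flip Gi
      = sandwich_comult_antipode (drinfeld_gamma_bar Q) G"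
proof -
  let ?bG = "right_contract \<beta> G"
  let ?V = "comult_at Q 3 0 Phi_inv \<otimes>\<^sub>4 e123 Phi"
  let ?W = "comult_at (twisted Q G) 3 0 (inv\<^bsub>T 3\<^esub> reassoc (twisted Q G))
      \<otimes>\<^sub>4 e123 (reassoc (twisted Q G))"
  let ?DD = "comult_at Q 3 0 (comult_at Q 2 (Suc 0) G)"
  let ?P = "comult_at Q 2 0 Gi \<otimes>\<^sub>3 e12 Gi"
  have comm: "e234 (e23 Gi) \<otimes>\<^sub>4 (e123 (e12 G) \<otimes>\<^sub>4 X) = e123 (e12 G) \<otimes>\<^sub>4 (e234 (e23 Gi) \<otimes>\<^sub>4 X)"
    if "X \<in> carrier (T 4)" for X
    using that leg12_leg34_commute[of G Gi] by (simp flip: T4.m_assoc)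
  have coassoc: "comult_at Q 3 0 (comult_at Q 2 0 Gi) \<otimes>\<^sub>4 (e123 Phi \<otimes>\<^sub>4 X)
      = e123 Phi \<otimes>\<^sub>4 (comult_at Q 3 (Suc 0) (comult_at Q 2 0 Gi) \<otimes>\<^sub>4 X)"
    if "X \<in> carrier (T 4)" for X
    using that comult_twice_reassoc(1)[of Gi] by (simp flip: T4.m_assoc)
  have W: "?W \<in> carrier (T 4)"
    unfolding twisted_reassoc_inv by (simp add: comult_at_twisted)
  have "e123 (e12 Gi) \<otimes>\<^sub>4 (e234 (e23 Gi) \<otimes>\<^sub>4 ?W)
      = ?DD \<otimes>\<^sub>4 ?V \<otimes>\<^sub>4 comult_at Q 3 (Suc 0) ?P \<otimes>\<^sub>4 e123 (e23 Gi)"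
    unfolding twisted_reassoc_inv
    by (simp add: comult_at_twisted hom_mult T4.m_assoc comult_at_legs(1,2) leg_cancel comm
        coassoc comult_at_leg12_rev)
  then have "Gi \<otimes>\<^sub>2 drinfeld_gamma_bar (twisted Q G) \<otimes>\<^sub>2 antipode_flip Gi
      = gamma_bar_map ?bG ?bG (?DD \<otimes>\<^sub>4 ?V \<otimes>\<^sub>4 comult_at Q 3 (Suc 0) ?P \<otimes>\<^sub>4 e123 (e23 Gi))"
    using gamma_map_outer(1)[OF W, of Gi Gi ?bG ?bG]
    by (simp add: drinfeld_gamma_bar_def gamma_bar_map_def)
  also have "\<dots> = gamma_bar_map ?bG \<beta> (?DD \<otimes>\<^sub>4 ?V \<otimes>\<^sub>4 comult_at Q 3 (Suc 0) ?P)"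
    by (simp add: T4.m_assoc leg_cancel flip: gamma_map_absorb(2))
  also have "\<dots> = gamma_bar_map ?bG \<beta> (?DD \<otimes>\<^sub>4 ?V \<otimes>\<^sub>4 leg14 (counit_middle ?P))"
    by (simp add: gamma_map_comult_middle)
  also have "counit_middle ?P = Gi"
    by (simp add: hom_mult counit_middle_comult counit_middle_e12 flip: one_low)
  also have "gamma_bar_map ?bG \<beta> (?DD \<otimes>\<^sub>4 ?V \<otimes>\<^sub>4 leg14 Gi) = gamma_bar_map \<beta> \<beta> (?DD \<otimes>\<^sub>4 ?V)"
    by (simp add: T4.m_assoc leg_cancel flip: gamma_map_absorb(1))
  also have "\<dots> = sandwich_comult_antipode (drinfeld_gamma_bar Q) G"
    by (simp add: gamma_map_comult_comult gamma_as_map)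
  finally show ?thesis .
qed

text \<open>
  The mirror image of \<open>gamma_bar_twisted\<close>, with \<open>\<alpha>\<close> absorbing from the left.
\<close>

lemma gamma_twisted:
  "antipode_flip G \<otimes>\<^sub>2 drinfeld_gamma (twisted Q G) \<otimes>\<^sub>2 G
      = sandwich_antipode_comult (drinfeld_gamma Q) Gi"
proof -
  let ?aG = "left_contract \<alpha> Gi"
  let ?U = "e123 Phi_inv \<otimes>\<^sub>4 comult_at Q 3 0 Phi"
  let ?W = "e123 (inv\<^bsub>T 3\<^esub> reassoc (twisted Q G))
      \<otimes>\<^sub>4 comult_at (twisted Q G) 3 0 (reassoc (twisted Q G))"
  let ?DD = "comult_at Q 3 0 (comult_at Q 2 (Suc 0) Gi)"
  let ?P = "e12 G \<otimes>\<^sub>3 comult_at Q 2 0 G"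
  have comm: "e234 (e23 Gi) \<otimes>\<^sub>4 (e123 (e12 Gi) \<otimes>\<^sub>4 X) = e123 (e12 Gi) \<otimes>\<^sub>4 (e234 (e23 Gi) \<otimes>\<^sub>4 X)"
    if "X \<in> carrier (T 4)" for X
    using that leg12_leg34_commute[of Gi Gi] by (simp flip: T4.m_assoc)
  have coassoc: "e123 Phi_inv \<otimes>\<^sub>4 (comult_at Q 3 0 (comult_at Q 2 0 G) \<otimes>\<^sub>4 X)
      = comult_at Q 3 (Suc 0) (comult_at Q 2 0 G) \<otimes>\<^sub>4 (e123 Phi_inv \<otimes>\<^sub>4 X)"
    if "X \<in> carrier (T 4)" for X
    using that comult_twice_reassoc(2)[of G] by (simp flip: T4.m_assoc)
  have W: "?W \<in> carrier (T 4)"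
    unfolding twisted_reassoc_inv by (simp add: comult_at_twisted)
  have "?W \<otimes>\<^sub>4 (e123 (e12 G) \<otimes>\<^sub>4 e234 (e23 G))
      = e123 (e23 G) \<otimes>\<^sub>4 (comult_at Q 3 (Suc 0) ?P \<otimes>\<^sub>4 (?U \<otimes>\<^sub>4 ?DD))"
    unfolding twisted_reassoc_inv
    by (simp add: comult_at_twisted hom_mult T4.m_assoc comult_at_legs(1,2) leg_cancel comm
        coassoc comult_at_leg12_rev)
  then have "antipode_flip G \<otimes>\<^sub>2 drinfeld_gamma (twisted Q G) \<otimes>\<^sub>2 G
      = gamma_map ?aG ?aG (e123 (e23 G) \<otimes>\<^sub>4 (comult_at Q 3 (Suc 0) ?P \<otimes>\<^sub>4 (?U \<otimes>\<^sub>4 ?DD)))"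
    using gamma_map_outer(2)[OF W, of G G ?aG ?aG]
    by (simp add: drinfeld_gamma_def gamma_map_def)
  also have "\<dots> = gamma_map \<alpha> ?aG (comult_at Q 3 (Suc 0) ?P \<otimes>\<^sub>4 (?U \<otimes>\<^sub>4 ?DD))"
    by (simp add: leg_cancel flip: gamma_map_absorb(4))
  also have "\<dots> = gamma_map \<alpha> ?aG (leg14 (counit_middle ?P) \<otimes>\<^sub>4 (?U \<otimes>\<^sub>4 ?DD))"
    by (simp add: gamma_map_comult_middle)
  also have "counit_middle ?P = G"
    by (simp add: hom_mult counit_middle_comult counit_middle_e12 flip: one_low)
  also have "gamma_map \<alpha> ?aG (leg14 G \<otimes>\<^sub>4 (?U \<otimes>\<^sub>4 ?DD)) = gamma_map \<alpha> \<alpha> (?U \<otimes>\<^sub>4 ?DD)"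
    by (simp add: leg_cancel flip: gamma_map_absorb(3))
  also have "\<dots> = sandwich_antipode_comult (drinfeld_gamma Q) Gi"
    by (simp add: gamma_map_comult_comult gamma_as_map)
  finally show ?thesis .
qed

lemma drinfeld_twist_as_map:
  "drinfeld_twist_inv Q = drinfeld_inv_map \<alpha> (drinfeld_gamma_bar Q) Phi"
  "drinfeld_twist Q = drinfeld_map (drinfeld_gamma Q) \<beta> Phi"
  by (simp_all add: drinfeld_twist_inv_def drinfeld_twist_def drinfeld_inv_map_def
      drinfeld_map_def antipode_flip_def)

lemma gammas_twisted_closed [simp]:
  "drinfeld_gamma_bar (twisted Q G) \<in> carrier (T 2)" "drinfeld_gamma (twisted Q G) \<in> carrier (T 2)"
  unfolding drinfeld_gamma_bar_def drinfeld_gamma_def twisted_simps(1,2)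
      twisted_reassoc_inv[unfolded twisted_simps(1)]
  by (auto intro!: tensor_lift_closed[OF multilinear_gamma_bar_map]
      tensor_lift_closed[OF multilinear_gamma_map]
      simp: comult_at_twisted simp del: One_nat_def)

theorem drinfeld_twist_inv_twisted:
  "drinfeld_twist_inv (twisted Q G) = G \<otimes>\<^sub>2 drinfeld_twist_inv Q \<otimes>\<^sub>2 antipode_flip G"
proof -
  let ?aG = "left_contract \<alpha> Gi"
    and ?g = "drinfeld_gamma_bar Q" and ?P = "reassoc (twisted Q G)"
  \<comment> \<open>The factors of the twisted coproducts next to \<open>\<gamma>\<close> are collected in \<open>k\<close>.\<close>
  define k where "k = Gi \<otimes>\<^sub>2 drinfeld_gamma_bar (twisted Q G) \<otimes>\<^sub>2 antipode_flip Gi"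
  have k [simp]: "k \<in> carrier (T 2)"
    by (simp add: k_def)
  have P: "?P \<in> carrier (T 3)" by simp
  have "drinfeld_twist_inv (twisted Q G) = tensor_lift (scal Q) 2
      (\<lambda>w. G \<otimes>\<^sub>2 (comult Q (S (w ! 0) * ?aG * (w ! 1)) \<otimes>\<^sub>2 k \<otimes>\<^sub>2 antipode_flip (comult Q (w ! 2)))
        \<otimes>\<^sub>2 antipode_flip G) ?P"
    unfolding drinfeld_twist_inv_def
    by (simp add: k_def antipode_flip_mult T2.m_assoc flip: antipode_flip_def)
  also have "\<dots> = G \<otimes>\<^sub>2 drinfeld_inv_map ?aG k ?P \<otimes>\<^sub>2 antipode_flip G"
    using tensor_lift_sandwich[OF multilinear_drinfeld_maps(3)[OF k], of G "antipode_flip G" ?P] P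
    by (simp add: drinfeld_inv_map_def)
  also have "drinfeld_inv_map ?aG k ?P = drinfeld_inv_map \<alpha> ?g (e12 Gi \<otimes>\<^sub>3 (?P \<otimes>\<^sub>3 e23 G))"
    using P by (simp add: k_def gamma_bar_twisted drinfeld_map_absorb del: twisted_simps)
  also have "e12 Gi \<otimes>\<^sub>3 (?P \<otimes>\<^sub>3 e23 G)
      = comult_at Q 2 0 G \<otimes>\<^sub>3 (Phi \<otimes>\<^sub>3 comult_at Q 2 (Suc 0) Gi)"
    by (simp add: T3.m_assoc leg_cancel)
  also have "drinfeld_inv_map \<alpha> ?g \<dots> = drinfeld_twist_inv Q"
    by (simp add: drinfeld_map_comult drinfeld_twist_as_map flip: one_low)
  finally show ?thesis .
qed

theorem drinfeld_twist_twisted: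
  "drinfeld_twist (twisted Q G) = antipode_flip Gi \<otimes>\<^sub>2 drinfeld_twist Q \<otimes>\<^sub>2 Gi"
proof -
  let ?bG = "right_contract \<beta> G"
    and ?g = "drinfeld_gamma Q" and ?P = "reassoc (twisted Q G)"
  define k where "k = antipode_flip G \<otimes>\<^sub>2 drinfeld_gamma (twisted Q G) \<otimes>\<^sub>2 G"
  have k [simp]: "k \<in> carrier (T 2)"
    by (simp add: k_def)
  have P: "?P \<in> carrier (T 3)" by simp
  have "drinfeld_twist (twisted Q G) = tensor_lift (scal Q) 2
      (\<lambda>w. antipode_flip Gi \<otimes>\<^sub>2 (antipode_flip (comult Q (w ! 0)) \<otimes>\<^sub>2 k
          \<otimes>\<^sub>2 comult Q ((w ! 1) * ?bG * S (w ! 2)))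
        \<otimes>\<^sub>2 Gi) ?P"
    unfolding drinfeld_twist_def
    by (simp add: k_def antipode_flip_mult T2.m_assoc flip: antipode_flip_def)
  also have "\<dots> = antipode_flip Gi \<otimes>\<^sub>2 drinfeld_map k ?bG ?P \<otimes>\<^sub>2 Gi"
    using tensor_lift_sandwich[OF multilinear_drinfeld_maps(4)[OF k], of "antipode_flip Gi" Gi ?P] P
    by (simp add: drinfeld_map_def)
  also have "drinfeld_map k ?bG ?P = drinfeld_map ?g \<beta> (e12 Gi \<otimes>\<^sub>3 (?P \<otimes>\<^sub>3 e23 G))"
    using P by (simp add: k_def gamma_twisted drinfeld_map_absorb del: twisted_simps)
  also have "e12 Gi \<otimes>\<^sub>3 (?P \<otimes>\<^sub>3 e23 G)
      = comult_at Q 2 0 G \<otimes>\<^sub>3 (Phi \<otimes>\<^sub>3 comult_at Q 2 (Suc 0) Gi)"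
    by (simp add: T3.m_assoc leg_cancel)
  also have "drinfeld_map ?g \<beta> \<dots> = drinfeld_twist Q"
    by (simp add: drinfeld_map_comult drinfeld_twist_as_map flip: one_low)
  finally show ?thesis .
qed

end

theorem theorem4:
  fixes Q :: "('k::field, 'h::ring_1) quasi_hopf"
    and G :: "('h, 'k) tensor"
  assumes "quasi_hopf_algebra Q"
    and "is_twist Q G"
  shows "drinfeld_twist_inv (twisted Q G) =
      G \<otimes>\<^bsub>tpow Q 2\<^esub> drinfeld_twist_inv Q
        \<otimes>\<^bsub>tpow Q 2\<^esub> antipode_tensor Q (tensor_flip (scal Q) G) \<and>
    (drinfeld_twist Q \<in> Units (tpow Q 2) \<longrightarrow>
      drinfeld_twist (twisted Q G) \<in> Units (tpow Q 2) \<and>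
      inv\<^bsub>tpow Q 2\<^esub> (drinfeld_twist (twisted Q G)) =
        G \<otimes>\<^bsub>tpow Q 2\<^esub> inv\<^bsub>tpow Q 2\<^esub> (drinfeld_twist Q)
          \<otimes>\<^bsub>tpow Q 2\<^esub> antipode_tensor Q (tensor_flip (scal Q) G))"
proof -
  interpret quasi_hopf_algebra_with_twist Q G
    using assms by (simp add: quasi_hopf_algebra_with_twist_def quasi_hopf_algebra_with_twist_axioms_def)
  have "drinfeld_twist (twisted Q G) \<in> Units (T 2) \<and>
      inv\<^bsub>T 2\<^esub> drinfeld_twist (twisted Q G) = G \<otimes>\<^bsub>T 2\<^esub> inv\<^bsub>T 2\<^esub> drinfeld_twist Q \<otimes>\<^bsub>T 2\<^esub> antipode_flip G"
    if F: "drinfeld_twist Q \<in> Units (T 2)"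
  proof -
    let ?F = "drinfeld_twist Q" and ?Fi = "inv\<^bsub>T 2\<^esub> drinfeld_twist Q"
    have [simp]: "?F \<in> carrier (T 2)" "?Fi \<in> carrier (T 2)"
      using F by auto
    have sg: "antipode_flip G \<otimes>\<^bsub>T 2\<^esub> antipode_flip Gi = \<one>\<^bsub>T 2\<^esub>" "antipode_flip Gi \<otimes>\<^bsub>T 2\<^esub> antipode_flip G = \<one>\<^bsub>T 2\<^esub>"
      by (simp_all flip: antipode_flip_mult)
    have c: "antipode_flip G \<otimes>\<^bsub>T 2\<^esub> (antipode_flip Gi \<otimes>\<^bsub>T 2\<^esub> X) = X" "Gi \<otimes>\<^bsub>T 2\<^esub> (G \<otimes>\<^bsub>T 2\<^esub> X) = X"
      "?F \<otimes>\<^bsub>T 2\<^esub> (?Fi \<otimes>\<^bsub>T 2\<^esub> X) = X" "?Fi \<otimes>\<^bsub>T 2\<^esub> (?F \<otimes>\<^bsub>T 2\<^esub> X) = X"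
      if "X \<in> carrier (T 2)" for X
      using that sg F by (simp_all flip: T2.m_assoc)
    have 1: "drinfeld_twist (twisted Q G) \<otimes>\<^bsub>T 2\<^esub> (G \<otimes>\<^bsub>T 2\<^esub> ?Fi \<otimes>\<^bsub>T 2\<^esub> antipode_flip G) = \<one>\<^bsub>T 2\<^esub>"
      and 2: "(G \<otimes>\<^bsub>T 2\<^esub> ?Fi \<otimes>\<^bsub>T 2\<^esub> antipode_flip G) \<otimes>\<^bsub>T 2\<^esub> drinfeld_twist (twisted Q G) = \<one>\<^bsub>T 2\<^esub>"
      by (simp_all add: drinfeld_twist_twisted T2.m_assoc c sg)
    have "drinfeld_twist (twisted Q G) \<in> carrier (T 2)"
      by (simp add: drinfeld_twist_twisted)
    moreover have "G \<otimes>\<^bsub>T 2\<^esub> ?Fi \<otimes>\<^bsub>T 2\<^esub> antipode_flip G \<in> carrier (T 2)"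
      by simp
    ultimately show ?thesis
      using 1 2 T2.inv_unique'[OF _ _ 1 2] unfolding Units_def by blast
  qed
  then show ?thesis
    using drinfeld_twist_inv_twisted by (simp add: antipode_flip_def)
qed

end
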